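(* Let $n\in\mathbb{N}$ ($n<\infty$) and $T\in\mathcal{S}_n(\mathcal{H})$. Let $w_T$ be the Livsic characteristic function of $T$ (constructed from any canonical self-adjoint extension $T'$ of $T$ and any orthonormal basis of $\mathrm{Ker}(T^*-iI)$). Let $\Gamma$ be a model for $T$ with auxiliary space $\mathcal{K}=\mathbb{C}^n$, let $K_\lambda(z)=\Gamma(z)^*\Gamma(\lambda)$, and let $$V(z)=\frac{z-i}{z+i}\,\Phi(z)^{-1}\Psi(z),\qquad \Phi(z)=K_i(z)K_i(i)^{-1/2},\quad \Psi(z)=K_{-i}(z)K_{-i}(-i)^{-1/2}.$$ Then there are constant unitary matrices $R,Q$ such that $$w_T(z)=R\,V(z)\,Q,\qquad z\in\mathbb{C}_+.$$
   Context: $\mathcal{S}_n(\mathcal{H})$ denotes the set of closed, densely defined linear operators $T:\mathscr{D}(T)\subset\mathcal{H}\to\mathcal{H}$ on a complex separable Hilbert space $\mathcal{H}$ that are symmetric, simple ($\bigcap_{\Im\lambda\neq0}\mathrm{Rng}(T-\lambda I)=\{0\}$), and have deficiency indices $(n,n)$, i.e. $\dim\mathrm{Rng}(T-iI)^\perp=\dim\mathrm{Rng}(T+iI)^\perp=n$. Inner products are linear in the first variable. A canonical self-adjoint extension of $T$ is a self-adjoint extension acting in the same space $\mathcal{H}$. $\mathbb{C}_\pm$ are the open upper/lower half planes. Livsic characteristic function: let $T'$ be a canonical self-adjoint extension of $T$ and $\{u_j\}_{j=1}^n$ an orthonormal basis of $\mathrm{Rng}(T+iI)^\perp=\mathrm{Ker}(T^*-iI)$.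 For $z\in\mathbb{C}_+$, $$w_T(z):=b(z)B(z)^{-1}A(z),\quad b(z)=\frac{z-i}{z+i},$$ $$B(z)=\big[\langle(I+(z-i)(T'-zI)^{-1})u_j,u_k\rangle\big]_{1\le j,k\le n},\quad A(z)=\big[\langle(I+(z+i)(T'-zI)^{-1})u_j,u_k\rangle\big]_{1\le j,k\le n}.$$ Here $[\langle Xu_j,u_k\rangle]$ denotes the matrix of (the compression of) $X$ in the basis $\{u_j\}$, i.e. $\langle Xu_j,u_k\rangle$ is the entry in column $j$ and row $k$. A model for $T$ (with $\mathcal{K}$ a Hilbert space of dimension $n$) is a map $\Gamma:\mathbb{C}\setminus\mathbb{R}\to\mathcal{B}(\mathcal{K},\mathcal{H})$ such that: (1) $\Gamma$ is co-analytic (analytic in $\overline{\lambda}$); (2) for each $\lambda\in\mathbb{C}\setminus\mathbb{R}$, $\Gamma(\lambda)$ is an invertible map from $\mathcal{K}$ onto $\mathrm{Rng}(T-\lambda I)^\perp$; (3) $\Gamma(z)^*\Gamma(\lambda):\mathcal{K}\to\mathcal{K}$ is invertible whenever $\lambda,z\in\mathbb{C}_+$ or $\lambda,z\in\mathbb{C}_-$; (4) the closed linear span of $\bigcup_{\Im\lambda\ne0}\mathrm{Rng}\,\Gamma(\lambda)$ is $\mathcal{H}$. *)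

theory Defs
  imports "HOL-Analysis.Analysis"
begin

section \<open>Complex Hilbert spaces\<close>

text \<open>The inner product is linear in its first argument.\<close>

class complex_inner = real_normed_vector +
  fixes scaleC :: "complex \<Rightarrow> 'a \<Rightarrow> 'a" (infixr "*\<^sub>C" 75)
    and cinner :: "'a \<Rightarrow> 'a \<Rightarrow> complex"
  assumes scaleC_add_right: "c *\<^sub>C (x + y) = c *\<^sub>C x + c *\<^sub>C y"
    and scaleC_add_left: "(c + d) *\<^sub>C x = c *\<^sub>C x + d *\<^sub>C x"
    and scaleC_scaleC: "c *\<^sub>C (d *\<^sub>C x) = (c * d) *\<^sub>C x"
    and scaleC_one: "1 *\<^sub>C x = x"
    and scaleR_eq_scaleC: "r *\<^sub>R x = complex_of_real r *\<^sub>C x"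
    and cinner_commute: "cinner x y = cnj (cinner y x)"
    and cinner_add_left: "cinner (x + y) z = cinner x z + cinner y z"
    and cinner_scaleC_left: "cinner (c *\<^sub>C x) y = c * cinner x y"
    and cinner_self_nonneg: "0 \<le> Re (cinner x x)"
    and cinner_self_eq_zero: "cinner x x = 0 \<longleftrightarrow> x = 0"
    and norm_eq_sqrt_cinner: "norm x = sqrt (Re (cinner x x))"

class chilbert_space = complex_inner + complete_space

global_interpretation complex_vector: vector_space "scaleC :: complex \<Rightarrow> 'a \<Rightarrow> 'a::complex_inner"
  defines csubspace = complex_vector.subspace
    and cspan = complex_vector.span
    and cdim = complex_vector.dim
  by unfold_locales (auto simp: scaleC_add_right scaleC_add_left scaleC_scaleC scaleC_one)

instantiation complex :: complex_inner
begin

definition scaleC_complex :: "complex \<Rightarrow> complex \<Rightarrow> complex"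
  where "scaleC_complex c x = c * x"

definition cinner_complex :: "complex \<Rightarrow> complex \<Rightarrow> complex"
  where "cinner_complex x y = x * cnj y"

instance
proof
  fix x :: complex
  show "norm x = sqrt (Re (cinner x x))"
    by (simp add: cinner_complex_def cmod_def power2_eq_square)
qed (auto simp: scaleC_complex_def cinner_complex_def algebra_simps scaleR_conv_of_real)

end

instance complex :: chilbert_space ..

instantiation vec :: (complex_inner, finite) complex_inner
begin

definition scaleC_vec :: "complex \<Rightarrow> ('a, 'b) vec \<Rightarrow> ('a, 'b) vec"
  where "scaleC_vec c x = (\<chi> i. c *\<^sub>C (x $ i))"

definition cinner_vec :: "('a, 'b) vec \<Rightarrow> ('a, 'b) vec \<Rightarrow> complex"
  where "cinner_vec x y = (\<Sum>i\<in>UNIV. cinner (x $ i) (y $ i))"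

instance
proof
  fix x y :: "('a, 'b) vec"
  have sq: "Re (cinner v v) = (norm v)\<^sup>2" for v :: 'a
    by (simp add: norm_eq_sqrt_cinner cinner_self_nonneg)
  have Re: "Re (cinner x x) = (\<Sum>i\<in>UNIV. (norm (x $ i))\<^sup>2)"
    by (simp add: cinner_vec_def sq)
  show "norm x = sqrt (Re (cinner x x))"
    by (simp add: Re norm_vec_def L2_set_def)
  show "0 \<le> Re (cinner x x)"
    by (simp add: Re sum_nonneg)
  show "cinner x x = 0 \<longleftrightarrow> x = 0"
  proof
    assume "cinner x x = 0"
    then have "(\<Sum>i\<in>UNIV. (norm (x $ i))\<^sup>2) = 0" using Re by simp
    then show "x = 0" by (simp add: sum_nonneg_eq_0_iff vec_eq_iff)
  next
    assume "x = 0"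
    then show "cinner x x = 0" by (simp add: cinner_vec_def cinner_self_eq_zero)
  qed
  show "cinner x y = cnj (cinner y x)"
    unfolding cinner_vec_def cnj_sum by (rule sum.cong) (auto intro: cinner_commute)
qed (auto simp: scaleC_vec_def cinner_vec_def vec_eq_iff scaleC_add_right scaleC_add_left
      scaleC_scaleC scaleC_one scaleR_eq_scaleC cinner_add_left cinner_scaleC_left
      sum.distrib sum_distrib_left)

end

instance vec :: (chilbert_space, finite) chilbert_space ..

definition orth_compl :: "'a::complex_inner set \<Rightarrow> 'a set"
  where "orth_compl S = {y. \<forall>x\<in>S. cinner x y = 0}"

text \<open>For a finite orthonormal family, the span is closed, so no closure is needed.\<close>

definition is_onb_of :: "('n::finite \<Rightarrow> 'a::complex_inner) \<Rightarrow> 'a set \<Rightarrow> bool"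
  where "is_onb_of u S \<longleftrightarrow>
    (\<forall>j k. cinner (u j) (u k) = (if j = k then 1 else 0)) \<and> cspan (range u) = S"

definition bounded_clinear :: "('a::complex_inner \<Rightarrow> 'b::complex_inner) \<Rightarrow> bool"
  where "bounded_clinear A \<longleftrightarrow> bounded_linear A \<and> (\<forall>c x. A (c *\<^sub>C x) = c *\<^sub>C A x)"

definition cadjoint :: "('a::complex_inner \<Rightarrow> 'b::complex_inner) \<Rightarrow> 'b \<Rightarrow> 'a"
  where "cadjoint A = (THE B. \<forall>x y. cinner (A x) y = cinner x (B y))"


section \<open>Unbounded operators\<close>

text \<open>
  An operator with domain \<open>D\<close> is a partial function \<open>T\<close> with \<open>dom T = D\<close>; its value at
  \<open>x \<in> dom T\<close> is \<open>the (T x)\<close>, and \<open>T \<subseteq>\<^sub>m T'\<close> says that \<open>T'\<close> extends \<open>T\<close>.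
\<close>

definition linear_op :: "('h::complex_inner \<rightharpoonup> 'h) \<Rightarrow> bool"
  where "linear_op T \<longleftrightarrow> csubspace (dom T) \<and>
    (\<forall>x\<in>dom T. \<forall>y\<in>dom T. the (T (x + y)) = the (T x) + the (T y)) \<and>
    (\<forall>c. \<forall>x\<in>dom T. the (T (c *\<^sub>C x)) = c *\<^sub>C the (T x))"

definition densely_defined :: "('h::complex_inner \<rightharpoonup> 'h) \<Rightarrow> bool"
  where "densely_defined T \<longleftrightarrow> closure (dom T) = UNIV"

definition closed_op :: "('h::complex_inner \<rightharpoonup> 'h) \<Rightarrow> bool"
  where "closed_op T \<longleftrightarrow> closed (Map.graph T)"

definition symmetric_op :: "('h::complex_inner \<rightharpoonup> 'h) \<Rightarrow> bool"
  where "symmetric_op T \<longleftrightarrow>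
    (\<forall>x\<in>dom T. \<forall>y\<in>dom T. cinner (the (T x)) y = cinner x (the (T y)))"

text \<open>The vector \<open>z\<close> below is unique whenever \<open>T\<close> is densely defined.\<close>

definition adjoint_op :: "('h::complex_inner \<rightharpoonup> 'h) \<Rightarrow> ('h \<rightharpoonup> 'h)"
  where "adjoint_op T = (\<lambda>y.
    if \<exists>z. \<forall>x\<in>dom T. cinner (the (T x)) y = cinner x z
    then Some (THE z. \<forall>x\<in>dom T. cinner (the (T x)) y = cinner x z)
    else None)"

definition selfadjoint_op :: "('h::complex_inner \<rightharpoonup> 'h) \<Rightarrow> bool"
  where "selfadjoint_op T \<longleftrightarrow> linear_op T \<and> densely_defined T \<and> adjoint_op T = T"

definition canonical_selfadjoint_extension ::
    "('h::complex_inner \<rightharpoonup> 'h) \<Rightarrow> ('h \<rightharpoonup> 'h) \<Rightarrow> bool"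
  where "canonical_selfadjoint_extension T T' \<longleftrightarrow> selfadjoint_op T' \<and> T \<subseteq>\<^sub>m T'"

definition Rng_shift :: "('h::complex_inner \<rightharpoonup> 'h) \<Rightarrow> complex \<Rightarrow> 'h set"
  where "Rng_shift T z = {the (T x) - z *\<^sub>C x | x. x \<in> dom T}"

definition Ker_shift :: "('h::complex_inner \<rightharpoonup> 'h) \<Rightarrow> complex \<Rightarrow> 'h set"
  where "Ker_shift T z = {x \<in> dom T. the (T x) - z *\<^sub>C x = 0}"

lemma cinner_add_right: "cinner x (y + z) = cinner x y + cinner x (z :: 'a::complex_inner)"
  using cinner_commute[of x "y + z"] cinner_commute[of x y] cinner_commute[of x z]
  by (simp add: cinner_add_left)

lemma cinner_scaleC_right: "cinner x (c *\<^sub>C y) = cnj c * cinner x (y :: 'a::complex_inner)"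
  using cinner_commute[of x "c *\<^sub>C y"] cinner_commute[of x y] by (simp add: cinner_scaleC_left)

lemma cinner_minus_right: "cinner x (- y) = - cinner x (y :: 'a::complex_inner)"
proof -
  have "cinner x 0 = 0" using cinner_add_right[of x 0 0] by simp
  then show ?thesis using cinner_add_right[of x y "- y"] by (simp add: add_eq_0_iff)
qed

lemma cinner_minus_left: "cinner (- x) y = - cinner x (y :: 'a::complex_inner)"
  using cinner_commute[of "- x" y] cinner_commute[of x y] by (simp add: cinner_minus_right)

lemma dense_orth_eq_zero:
  fixes d :: "'a::complex_inner"
  assumes dense: "closure S = UNIV" and orth: "\<And>x. x \<in> S \<Longrightarrow> cinner x d = 0"
  shows "d = 0"
proof (rule ccontr)
  assume "d \<noteq> 0"
  have sq: "Re (cinner v v) = (norm v)\<^sup>2" for v :: 'a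
    by (simp add: norm_eq_sqrt_cinner cinner_self_nonneg)
  obtain x where x: "x \<in> S" "dist x d < norm d"
    using closure_approachable[of d S] dense \<open>d \<noteq> 0\<close> zero_less_norm_iff[of d] by blast
  have "cinner d x = 0" using orth[OF x(1)] cinner_commute[of d x] by simp
  then have "cinner (x + - d) (x + - d) = cinner x x + cinner d d"
    using orth[OF x(1)]
    by (simp only: cinner_add_left cinner_add_right cinner_minus_left cinner_minus_right) simp
  then have "(norm (x - d))\<^sup>2 = (norm x)\<^sup>2 + (norm d)\<^sup>2"
    using sq[of "x + - d"] sq[of x] sq[of d] by simp
  then have "(norm d)\<^sup>2 \<le> (norm (x - d))\<^sup>2" by simp
  then show False using x(2) by (simp add: dist_norm)
qed

lemma adjoint_op_eq_Some_iff:
  assumes "densely_defined T"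
  shows "adjoint_op T y = Some z \<longleftrightarrow> (\<forall>x\<in>dom T. cinner (the (T x)) y = cinner x z)"
proof -
  let ?P = "\<lambda>z. \<forall>x\<in>dom T. cinner (the (T x)) y = cinner x z"
  have uniq: "a = b" if "?P a" "?P b" for a b
  proof -
    have "cinner x (a + - b) = 0" if "x \<in> dom T" for x
      using \<open>?P a\<close>[rule_format, OF that] \<open>?P b\<close>[rule_format, OF that]
      unfolding cinner_add_right cinner_minus_right by simp
    then have "a + - b = 0"
      using assms unfolding densely_defined_def by (intro dense_orth_eq_zero[of "dom T"])
    then show ?thesis by simp
  qed
  have the: "(THE z. ?P z) = a" if "?P a" for a
    by (rule the_equality[of ?P a], rule that, erule uniq[OF _ that])
  show ?thesis
  proof (cases "\<exists>z. ?P z")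
    case True
    then obtain a where a: "?P a" by blast
    have "adjoint_op T y = Some a"
      unfolding adjoint_op_def using True by (simp only: the[OF a] if_True)
    moreover have "?P z \<longleftrightarrow> a = z" using a uniq by blast
    ultimately show ?thesis by (simp only: option.inject)
  next
    case False
    then have "adjoint_op T y = None"
      unfolding adjoint_op_def by (simp only: if_False)
    with False show ?thesis by (metis option.distinct(1))
  qed
qed

lemma Ker_shift_adjoint_op:
  assumes "densely_defined T"
  shows "Ker_shift (adjoint_op T) z = orth_compl (Rng_shift T (cnj z))"
proof -
  have "y \<in> Ker_shift (adjoint_op T) z \<longleftrightarrow> adjoint_op T y = Some (z *\<^sub>C y)" for y
    by (auto simp: Ker_shift_def)
  moreover have "cinner (the (T x) - cnj z *\<^sub>C x) y = cinner (the (T x)) y - cinner x (z *\<^sub>C y)"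
    for x y
    using cinner_add_left[of "the (T x)" "- (cnj z *\<^sub>C x)" y]
    by (simp add: cinner_minus_left cinner_scaleC_left cinner_scaleC_right)
  moreover have "y \<in> orth_compl (Rng_shift T (cnj z)) \<longleftrightarrow>
      (\<forall>x\<in>dom T. cinner (the (T x) - cnj z *\<^sub>C x) y = 0)" for y
    unfolding orth_compl_def Rng_shift_def by blast
  ultimately show ?thesis
    by (simp add: set_eq_iff adjoint_op_eq_Some_iff[OF assms])
qed

definition resolvent :: "('h::complex_inner \<rightharpoonup> 'h) \<Rightarrow> complex \<Rightarrow> 'h \<Rightarrow> 'h"
  where "resolvent T z y = (THE x. x \<in> dom T \<and> the (T x) - z *\<^sub>C x = y)"

definition simple_op :: "('h::complex_inner \<rightharpoonup> 'h) \<Rightarrow> bool"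
  where "simple_op T \<longleftrightarrow> (\<Inter>z\<in>{z. Im z \<noteq> 0}. Rng_shift T z) = {0}"

text \<open>
  The dimension \<open>cdim\<close> of an infinite-dimensional space is \<open>0\<close>. For \<open>n > 0\<close> the dimension
  conditions below therefore include finite-dimensionality.
\<close>

definition deficiency_class :: "nat \<Rightarrow> ('h::chilbert_space \<rightharpoonup> 'h) set" ("\<S>")
  where "\<S> n = {T. linear_op T \<and> densely_defined T \<and> closed_op T \<and> symmetric_op T \<and> simple_op T \<and>
    cdim (orth_compl (Rng_shift T \<i>)) = n \<and> cdim (orth_compl (Rng_shift T (- \<i>))) = n}"


section \<open>Matrices\<close>

text \<open>In \<open>M $ k $ j\<close> the first index is the row and the second one the column.\<close>

definition adjoint_matrix :: "complex^'n^'m \<Rightarrow> complex^'m^'n"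
  where "adjoint_matrix M = (\<chi> k j. cnj (M $ j $ k))"

definition unitary_matrix :: "complex^'n^'n \<Rightarrow> bool"
  where "unitary_matrix M \<longleftrightarrow> adjoint_matrix M ** M = mat 1 \<and> M ** adjoint_matrix M = mat 1"

text \<open>Over the complex numbers, a matrix with real quadratic form is automatically Hermitian.\<close>

definition pos_semidef :: "complex^'n^'n \<Rightarrow> bool"
  where "pos_semidef M \<longleftrightarrow> (\<forall>x. cinner (M *v x) x \<in> \<real>\<^sub>\<ge>\<^sub>0)"

text \<open>A positive semidefinite matrix has exactly one positive semidefinite square root.\<close>

definition matrix_sqrt :: "complex^'n^'n \<Rightarrow> complex^'n^'n"
  where "matrix_sqrt M = (THE S. pos_semidef S \<and> S ** S = M)"

definition matrix_inv_sqrt :: "complex^'n^'n \<Rightarrow> complex^'n^'n"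
  where "matrix_inv_sqrt M = matrix_inv (matrix_sqrt M)"


section \<open>The Livsic characteristic function\<close>

definition b_factor :: "complex \<Rightarrow> complex"
  where "b_factor z = (z - \<i>) / (z + \<i>)"

definition livsic_B :: "('h::complex_inner \<rightharpoonup> 'h) \<Rightarrow> ('n::finite \<Rightarrow> 'h) \<Rightarrow> complex \<Rightarrow> complex^'n^'n"
  where "livsic_B T' u z =
    (\<chi> k j. cinner (u j + (z - \<i>) *\<^sub>C resolvent T' z (u j)) (u k))"

definition livsic_A :: "('h::complex_inner \<rightharpoonup> 'h) \<Rightarrow> ('n::finite \<Rightarrow> 'h) \<Rightarrow> complex \<Rightarrow> complex^'n^'n"
  where "livsic_A T' u z =
    (\<chi> k j. cinner (u j + (z + \<i>) *\<^sub>C resolvent T' z (u j)) (u k))"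

definition livsic_w :: "('h::complex_inner \<rightharpoonup> 'h) \<Rightarrow> ('n::finite \<Rightarrow> 'h) \<Rightarrow> complex \<Rightarrow> complex^'n^'n"
  where "livsic_w T' u z = b_factor z *\<^sub>C (matrix_inv (livsic_B T' u z) ** livsic_A T' u z)"


section \<open>Models\<close>

text \<open>
  Complex differentiability with respect to \<open>cnj z\<close>, in operator norm, on the open set of
  non-real numbers.
\<close>

definition coanalytic :: "(complex \<Rightarrow> 'k::complex_inner \<Rightarrow> 'h::complex_inner) \<Rightarrow> bool"
  where "coanalytic \<Gamma> \<longleftrightarrow>
    (\<forall>z. Im z \<noteq> 0 \<longrightarrow> (\<exists>D. bounded_clinear D \<and>
      ((\<lambda>w. onorm (\<lambda>x. (1 / (cnj w - cnj z)) *\<^sub>C (\<Gamma> w x - \<Gamma> z x) - D x)) \<longlongrightarrow> 0) (at z)))"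

definition model_kernel ::
    "(complex \<Rightarrow> 'k::complex_inner \<Rightarrow> 'h::complex_inner) \<Rightarrow> complex \<Rightarrow> complex \<Rightarrow> 'k \<Rightarrow> 'k"
  where "model_kernel \<Gamma> l z = cadjoint (\<Gamma> z) \<circ> \<Gamma> l"

text \<open>
  The values of \<open>\<Gamma>\<close> at real points are irrelevant. By the open mapping theorem a bijective
  bounded operator between Hilbert spaces has a bounded inverse.
\<close>

definition is_model ::
    "('h::chilbert_space \<rightharpoonup> 'h) \<Rightarrow> (complex \<Rightarrow> 'k::chilbert_space \<Rightarrow> 'h) \<Rightarrow> bool"
  where "is_model T \<Gamma> \<longleftrightarrow>
    (\<forall>z. Im z \<noteq> 0 \<longrightarrow> bounded_clinear (\<Gamma> z)) \<and>
    coanalytic \<Gamma> \<and>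
    (\<forall>z. Im z \<noteq> 0 \<longrightarrow> bij_betw (\<Gamma> z) UNIV (orth_compl (Rng_shift T z))) \<and>
    (\<forall>l z. (0 < Im l \<and> 0 < Im z) \<or> (Im l < 0 \<and> Im z < 0) \<longrightarrow> bij (model_kernel \<Gamma> l z)) \<and>
    closure (cspan (\<Union>z\<in>{z. Im z \<noteq> 0}. range (\<Gamma> z))) = UNIV"

definition kernel_matrix ::
    "(complex \<Rightarrow> complex^'n \<Rightarrow> 'h::complex_inner) \<Rightarrow> complex \<Rightarrow> complex \<Rightarrow> complex^'n^'n"
  where "kernel_matrix \<Gamma> l z = matrix (model_kernel \<Gamma> l z)"

definition model_Phi :: "(complex \<Rightarrow> complex^'n \<Rightarrow> 'h::complex_inner) \<Rightarrow> complex \<Rightarrow> complex^'n^'n"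
  where "model_Phi \<Gamma> z = kernel_matrix \<Gamma> \<i> z ** matrix_inv_sqrt (kernel_matrix \<Gamma> \<i> \<i>)"

definition model_Psi :: "(complex \<Rightarrow> complex^'n \<Rightarrow> 'h::complex_inner) \<Rightarrow> complex \<Rightarrow> complex^'n^'n"
  where "model_Psi \<Gamma> z =
    kernel_matrix \<Gamma> (- \<i>) z ** matrix_inv_sqrt (kernel_matrix \<Gamma> (- \<i>) (- \<i>))"

definition model_V :: "(complex \<Rightarrow> complex^'n \<Rightarrow> 'h::complex_inner) \<Rightarrow> complex \<Rightarrow> complex^'n^'n"
  where "model_V \<Gamma> z = b_factor z *\<^sub>C (matrix_inv (model_Phi \<Gamma> z) ** model_Psi \<Gamma> z)"

end

theory Submission
  imports Defs
begin

text \<open>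
  For a self-adjoint extension \<open>T'\<close> of \<open>T\<close>, the operators \<open>U a b = (T' - b) (T' - a)\<^sup>-\<^sup>1\<close> satisfy
  \<open>U a b \<circ> U b c = U a c\<close> and \<open>(U a b)\<^sup>* = U (cnj a) (cnj b)\<close>, and \<open>U a b\<close> maps
  \<open>Ker (T\<^sup>* - b)\<close> onto \<open>Ker (T\<^sup>* - a)\<close>. With \<open>f a j = U a \<i> (u j)\<close> it follows that \<open>B(z)\<close> and \<open>A(z)\<close>
  are the matrices of inner products of the \<open>f (-\<i>) j\<close>, respectively of the \<open>f \<i> j = u j\<close>, with the
  \<open>f (cnj z) k\<close>, and that \<open>f (-\<i>)\<close> is orthonormal. The columns of \<open>\<Gamma>(z)\<close> are linear combinations of
  the \<open>f (cnj z) k\<close>, with coefficient matrix \<open>C(z)\<close>, so that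
  \<open>\<Phi>(z) = C(z)\<^sup>* B(z) P\<close> and \<open>\<Psi>(z) = C(z)\<^sup>* A(z) Q\<close>, where \<open>P = C(\<i>) K\<^sub>\<i>(\<i>)\<^sup>-\<^sup>1\<^sup>/\<^sup>2\<close> and
  \<open>Q = C(-\<i>) K\<^sub>-\<^sub>\<i>(-\<i>)\<^sup>-\<^sup>1\<^sup>/\<^sup>2\<close>. Both are unitary because \<open>K\<^sub>\<i>(\<i>) = C(\<i>)\<^sup>* C(\<i>)\<close>, and likewise for
  \<open>-\<i>\<close>. In \<open>\<Phi>(z)\<^sup>-\<^sup>1 \<Psi>(z)\<close> the factor \<open>C(z)\<^sup>*\<close> cancels.
\<close>

section \<open>Hilbert space geometry\<close>

lemma cinner_diff_left: "cinner (x - y) z = cinner x z - cinner y (z :: 'a::complex_inner)"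
  using cinner_add_left[of x "- y" z] by (simp add: cinner_minus_left)

lemma cinner_diff_right: "cinner x (y - z) = cinner x y - cinner x (z :: 'a::complex_inner)"
  using cinner_add_right[of x y "- z"] by (simp add: cinner_minus_right)

lemma cinner_zero_left [simp]: "cinner 0 (x :: 'a::complex_inner) = 0"
  using cinner_diff_left[of x x x] by simp

lemma cinner_zero_right [simp]: "cinner (x :: 'a::complex_inner) 0 = 0"
  using cinner_diff_right[of x x x] by simp

lemma cinner_sum_left: "cinner (\<Sum>i\<in>I. f i) (y :: 'a::complex_inner) = (\<Sum>i\<in>I. cinner (f i) y)"
  by (induction I rule: infinite_finite_induct) (auto simp: cinner_add_left)

lemma cinner_sum_right: "cinner (y :: 'a::complex_inner) (\<Sum>i\<in>I. f i) = (\<Sum>i\<in>I. cinner y (f i))"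
  by (induction I rule: infinite_finite_induct) (auto simp: cinner_add_right)

lemmas cinner_simps = cinner_add_left cinner_add_right cinner_diff_left cinner_diff_right
  cinner_scaleC_left cinner_scaleC_right cinner_minus_left cinner_minus_right

lemma cinner_self: "cinner x x = complex_of_real ((norm (x :: 'a::complex_inner))\<^sup>2)"
proof -
  have "Im (cinner x x) = 0"
    using arg_cong[OF cinner_commute[of x x], of Im] by simp
  moreover have "Re (cinner x x) = (norm x)\<^sup>2"
    by (simp add: norm_eq_sqrt_cinner cinner_self_nonneg)
  ultimately show ?thesis by (simp add: complex_eq_iff)
qed

lemma Re_cinner_self: "Re (cinner x x) = (norm (x :: 'a::complex_inner))\<^sup>2"
  by (simp add: cinner_self)

lemma cinner_Cauchy_Schwarz: "cmod (cinner x y) \<le> norm x * norm (y :: 'a::complex_inner)"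
proof (cases "y = 0")
  case False
  \<comment> \<open>\<open>c *\<^sub>C y\<close> is the orthogonal projection of \<open>x\<close>
    onto the line through \<open>y\<close>; the inequality says that the squared norm of the
    remainder is nonnegative.\<close>
  define c where "c = cinner x y / complex_of_real ((norm y)\<^sup>2)"
  have [simp]: "cinner y x = cnj (cinner x y)" by (rule cinner_commute)
  have ny: "norm y \<noteq> 0" using False by simp
  have "complex_of_real ((norm (x - c *\<^sub>C y))\<^sup>2) = cinner (x - c *\<^sub>C y) (x - c *\<^sub>C y)"
    by (rule cinner_self[symmetric])
  also have "\<dots> = cinner x x - cnj c * cinner x y - c * cnj (cinner x y) + c * cnj c * cinner y y"
    by (simp add: cinner_simps algebra_simps)
  also have "\<dots> = complex_of_real ((norm x)\<^sup>2 - (cmod (cinner x y))\<^sup>2 / (norm y)\<^sup>2)"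
    using ny unfolding cinner_self c_def
    by (simp add: field_simps power2_eq_square complex_norm_square[unfolded power2_eq_square]
        flip: of_real_mult)
  finally have "(norm x)\<^sup>2 - (cmod (cinner x y))\<^sup>2 / (norm y)\<^sup>2 = (norm (x - c *\<^sub>C y))\<^sup>2"
    by (simp only: of_real_eq_iff)
  then have "(cmod (cinner x y))\<^sup>2 / (norm y)\<^sup>2 \<le> (norm x)\<^sup>2"
    by (metis diff_ge_0_iff_ge zero_le_power2)
  then have "(cmod (cinner x y))\<^sup>2 \<le> (norm x * norm y)\<^sup>2"
    using ny by (simp add: divide_le_eq power_mult_distrib)
  then show ?thesis by (rule power2_le_imp_le) simp
qed simp

lemma parallelogram_law:
  fixes x y :: "'a::complex_inner"
  shows "(norm (x + y))\<^sup>2 + (norm (x - y))\<^sup>2 = 2 * (norm x)\<^sup>2 + 2 * (norm y)\<^sup>2"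
  by (simp add: Re_cinner_self[symmetric] cinner_simps)

lemma norm_scaleC: "norm (c *\<^sub>C x) = cmod c * norm (x :: 'a::complex_inner)"
proof -
  have "complex_of_real ((norm (c *\<^sub>C x))\<^sup>2) = complex_of_real ((cmod c * norm x)\<^sup>2)"
    unfolding cinner_self[symmetric] cinner_simps
    by (simp add: cinner_self power_mult_distrib complex_norm_square flip: of_real_power)
  then show ?thesis by (simp only: of_real_eq_iff) (simp add: power2_eq_iff_nonneg)
qed

lemma tendsto_cinner_right:
  fixes f :: "'b \<Rightarrow> 'a::complex_inner"
  assumes "(f \<longlongrightarrow> l) F"
  shows "((\<lambda>i. cinner a (f i)) \<longlongrightarrow> cinner a l) F"
proof -
  have "((\<lambda>i. norm a * norm (f i - l)) \<longlongrightarrow> norm a * 0) F"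
    by (intro tendsto_mult tendsto_const tendsto_norm_zero LIM_zero assms)
  then have "((\<lambda>i. norm a * norm (f i - l)) \<longlongrightarrow> 0) F" by simp
  then have "((\<lambda>i. cinner a (f i - l)) \<longlongrightarrow> 0) F"
    by (rule Lim_null_comparison[rotated])
      (auto intro: always_eventually cinner_Cauchy_Schwarz)
  then show ?thesis by (simp add: cinner_diff_right LIM_zero_iff)
qed

lemma tendsto_scaleC:
  fixes f :: "'b \<Rightarrow> 'a::complex_inner"
  assumes "(f \<longlongrightarrow> l) F"
  shows "((\<lambda>i. c *\<^sub>C f i) \<longlongrightarrow> c *\<^sub>C l) F"
proof -
  have "((\<lambda>i. cmod c * norm (f i - l)) \<longlongrightarrow> cmod c * 0) F"
    by (intro tendsto_mult tendsto_const tendsto_norm_zero LIM_zero assms)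
  then have "((\<lambda>i. cmod c * norm (f i - l)) \<longlongrightarrow> 0) F" by simp
  then have "((\<lambda>i. c *\<^sub>C (f i - l)) \<longlongrightarrow> 0) F"
    by (rule Lim_null_comparison[rotated])
      (auto intro: always_eventually simp: norm_scaleC)
  then show ?thesis
    by (simp add: complex_vector.scale_right_diff_distrib LIM_zero_iff)
qed

text \<open>A minimizing sequence for the distance is Cauchy by the parallelogram law; completeness
  and closedness then put its limit in \<open>S\<close>.\<close>

lemma closest_point_in_closed_subspace:
  fixes S :: "'a::chilbert_space set"
  assumes S: "csubspace S" and cl: "closed S"
  obtains p where "p \<in> S" "\<And>s. s \<in> S \<Longrightarrow> norm (x - p) \<le> norm (x - s)"
proof -
  define d where "d = (INF s\<in>S. (norm (x - s))\<^sup>2)"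
  have ne: "S \<noteq> {}" using complex_vector.subspace_0[OF S] by blast
  have bdd: "bdd_below ((\<lambda>s. (norm (x - s))\<^sup>2) ` S)" by (rule bdd_belowI[of _ 0]) auto
  have lower: "d \<le> (norm (x - s))\<^sup>2" if "s \<in> S" for s
    unfolding d_def using bdd that by (rule cINF_lower)
  have "\<exists>s\<in>S. (norm (x - s))\<^sup>2 < d + 1 / real (Suc n)" for n
    using cINF_less_iff[OF ne bdd, of "d + 1 / real (Suc n)"] unfolding d_def by simp
  then obtain s where sS: "\<And>n. s n \<in> S" and s: "\<And>n. (norm (x - s n))\<^sup>2 < d + 1 / real (Suc n)"
    by metis
  \<comment> \<open>The midpoint of \<open>s m\<close> and \<open>s n\<close> lies in
    \<open>S\<close>, so its squared distance to \<open>x\<close> is at least \<open>d\<close>; this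
    bounds the sum term of the parallelogram law from below.\<close>
  have mid: "(norm (s m - s n))\<^sup>2 \<le> 2 / real (Suc m) + 2 / real (Suc n)" for m n
  proof -
    have "(1/2 :: complex) *\<^sub>C (s m + s n) \<in> S"
      using S sS by (intro complex_vector.subspace_scale complex_vector.subspace_add)
    then have *: "d \<le> (norm (x - (1/2 :: complex) *\<^sub>C (s m + s n)))\<^sup>2" by (rule lower)
    have "(x - s m) + (x - s n) = (2::complex) *\<^sub>C (x - (1/2 :: complex) *\<^sub>C (s m + s n))"
      using scaleR_eq_scaleC[of 2 x]
      by (simp add: complex_vector.scale_right_diff_distrib scaleC_scaleC scaleC_one scaleR_2)
    then have "(norm ((x - s m) + (x - s n)))\<^sup>2 = 4 * (norm (x - (1/2 :: complex) *\<^sub>C (s m + s n)))\<^sup>2"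
      by (simp add: norm_scaleC power_mult_distrib)
    with * have "4 * d \<le> (norm ((x - s m) + (x - s n)))\<^sup>2" by simp
    moreover have "norm ((x - s m) - (x - s n)) = norm (s m - s n)"
      by (simp add: norm_minus_commute)
    ultimately show ?thesis
      using parallelogram_law[of "x - s m" "x - s n"] s[of m] s[of n] by simp
  qed
  have "Cauchy s"
  proof (rule metric_CauchyI)
    fix e :: real assume "e > 0"
    \<comment> \<open>This \<open>N\<close> makes each of the two fractions in \<open>mid\<close>
      smaller than half of \<open>e\<^sup>2\<close>.\<close>
    then obtain N where N: "4 / e\<^sup>2 < real N" using reals_Archimedean2 by blast
    have "dist (s m) (s n) < e" if "N \<le> m" "N \<le> n" for m n
    proof -
      have "2 / real (Suc k) < e\<^sup>2 / 2" if "N \<le> k" for k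
      proof -
        have "4 / e\<^sup>2 < real (Suc k)" using N that by linarith
        then show ?thesis using \<open>e > 0\<close> by (simp add: field_simps del: of_nat_Suc)
      qed
      from this[OF that(1)] this[OF that(2)] have "(norm (s m - s n))\<^sup>2 < e\<^sup>2"
        using mid[of m n] by linarith
      then show ?thesis unfolding dist_norm
        using \<open>e > 0\<close> by (auto intro: power2_less_imp_less)
    qed
    then show "\<exists>M. \<forall>m\<ge>M. \<forall>n\<ge>M. dist (s m) (s n) < e" by blast
  qed
  then obtain p where p: "s \<longlonglongrightarrow> p" using Cauchy_convergent convergent_def by blast
  have pS: "p \<in> S" using cl sS p by (rule closed_sequentially)
  have "(\<lambda>n. (norm (x - s n))\<^sup>2) \<longlonglongrightarrow> (norm (x - p))\<^sup>2"
    by (intro tendsto_intros p)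
  moreover have "(\<lambda>n. d + 1 / real (Suc n)) \<longlonglongrightarrow> d + 0"
    by (intro tendsto_add tendsto_const LIMSEQ_Suc lim_1_over_n)
  ultimately have "(norm (x - p))\<^sup>2 \<le> d + 0"
    using less_imp_le[OF s] by (rule LIMSEQ_le[OF _ _ exI[of _ 0], rule_format])
  then have "norm (x - p) \<le> norm (x - t)" if "t \<in> S" for t
    using power2_le_imp_le[OF order_trans[OF _ lower[OF that]]] by simp
  with pS show ?thesis by (rule that)
qed

text \<open>The difference between a vector and its closest point in \<open>S\<close> is orthogonal
  to \<open>S\<close>, hence zero.\<close>

lemma closed_csubspace_eq_UNIV:
  fixes S :: "'a::chilbert_space set"
  assumes S: "csubspace S" and cl: "closed S" and orth: "orth_compl S = {0}"
  shows "S = UNIV"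
proof -
  have "x \<in> S" for x
  proof -
    obtain p where p: "p \<in> S" "\<And>s. s \<in> S \<Longrightarrow> norm (x - p) \<le> norm (x - s)"
      using closest_point_in_closed_subspace[OF S cl] by blast
    have "cinner s (x - p) = 0" if "s \<in> S" for s
    proof (cases "s = 0")
      case False
      define a where "a = cinner (x - p) s"
      \<comment> \<open>Moving \<open>p\<close> by \<open>c *\<^sub>C s\<close> lowers the squared
        distance by the square of \<open>cmod a / norm s\<close>, which minimality allows only for
        \<open>a = 0\<close>.\<close>
      define c where "c = a / complex_of_real ((norm s)\<^sup>2)"
      have ns: "norm s \<noteq> 0" using False by simp
      have [simp]: "cinner s (x - p) = cnj a" unfolding a_def by (rule cinner_commute)
      have "complex_of_real ((norm (x - (p + c *\<^sub>C s)))\<^sup>2) = cinner ((x - p) - c *\<^sub>C s) ((x - p) - c *\<^sub>C s)"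
        by (simp only: cinner_self diff_diff_eq)
      also have "\<dots> = cinner (x - p) (x - p) - cnj c * a - c * cnj a + c * cnj c * cinner s s"
        unfolding cinner_diff_left[of "x - p" "c *\<^sub>C s"] cinner_diff_right[of _ "x - p" "c *\<^sub>C s"]
        by (simp add: cinner_scaleC_left cinner_scaleC_right algebra_simps flip: a_def)
      also have "\<dots> = complex_of_real ((norm (x - p))\<^sup>2 - (cmod a)\<^sup>2 / (norm s)\<^sup>2)"
        using ns unfolding cinner_self c_def
        by (simp add: field_simps power2_eq_square complex_norm_square[unfolded power2_eq_square]
            flip: of_real_mult)
      finally have "(norm (x - (p + c *\<^sub>C s)))\<^sup>2 = (norm (x - p))\<^sup>2 - (cmod a)\<^sup>2 / (norm s)\<^sup>2"
        by (simp only: of_real_eq_iff)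
      moreover have "(norm (x - p))\<^sup>2 \<le> (norm (x - (p + c *\<^sub>C s)))\<^sup>2"
        using S p(1) that
        by (intro power_mono p(2) complex_vector.subspace_add complex_vector.subspace_scale) auto
      ultimately have "(cmod a)\<^sup>2 / (norm s)\<^sup>2 \<le> 0" by simp
      then show ?thesis using ns by (simp add: divide_le_0_iff)
    qed simp
    then have "x - p \<in> orth_compl S" unfolding orth_compl_def by blast
    with orth p(1) show ?thesis by simp
  qed
  then show ?thesis by blast
qed

section \<open>Resolvents of self-adjoint operators\<close>

text \<open>The half of self-adjointness that goes beyond symmetry: a weak solution already lies in
  the domain. Both the closedness of the range of T - z and the triviality of its orthogonal
  complement rest on it.\<close>

lemma selfadjoint_op_domI:
  assumes "selfadjoint_op T" "\<And>x. x \<in> dom T \<Longrightarrow> cinner (the (T x)) y = cinner x w"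
  shows "y \<in> dom T" "the (T y) = w"
proof -
  have "adjoint_op T y = Some w"
    using assms adjoint_op_eq_Some_iff[of T y w] unfolding selfadjoint_op_def by blast
  then have "T y = Some w" using assms(1) unfolding selfadjoint_op_def by simp
  then show "y \<in> dom T" "the (T y) = w" by auto
qed

lemma selfadjoint_op_symmetric:
  assumes "selfadjoint_op T" "x \<in> dom T" "y \<in> dom T"
  shows "cinner (the (T x)) y = cinner x (the (T y))"
proof -
  have "adjoint_op T y = Some (the (T y))"
    using assms unfolding selfadjoint_op_def by auto
  then show ?thesis
    using assms adjoint_op_eq_Some_iff[of T y "the (T y)"] unfolding selfadjoint_op_def by blast
qed

text \<open>Symmetry makes the inner product of T x with x real, so the imaginary part of that of (T
  - z) x with x comes from \<open>z\<close> alone; Cauchy-Schwarz bounds it. For nonreal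
  \<open>z\<close> this gives injectivity of T - z with control of preimages.\<close>

lemma selfadjoint_op_shift_bounded_below:
  assumes "selfadjoint_op T" "x \<in> dom T"
  shows "\<bar>Im z\<bar> * norm x \<le> norm (the (T x) - z *\<^sub>C x)"
proof (cases "x = 0")
  case False
  have "Im (cinner (the (T x)) x) = 0"
    using arg_cong[OF cinner_commute[of "the (T x)" x], of Im]
      selfadjoint_op_symmetric[OF assms(1) assms(2) assms(2)] by simp
  then have "Im (cinner (the (T x) - z *\<^sub>C x) x) = - Im z * (norm x)\<^sup>2"
    by (simp add: cinner_simps cinner_self)
  then have "\<bar>Im z\<bar> * (norm x)\<^sup>2 \<le> cmod (cinner (the (T x) - z *\<^sub>C x) x)"
    using abs_Im_le_cmod[of "cinner (the (T x) - z *\<^sub>C x) x"] by (simp add: abs_mult)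
  also have "\<dots> \<le> norm (the (T x) - z *\<^sub>C x) * norm x" by (rule cinner_Cauchy_Schwarz)
  finally show ?thesis using False by (simp add: power2_eq_square)
qed simp

section \<open>Ranges of T - z\<close>

lemma linear_op_shift:
  assumes "linear_op T" "x \<in> dom T" "y \<in> dom T"
  shows "x + y \<in> dom T" "the (T (x + y)) - z *\<^sub>C (x + y) = (the (T x) - z *\<^sub>C x) + (the (T y) - z *\<^sub>C y)"
    and "c *\<^sub>C x \<in> dom T" "the (T (c *\<^sub>C x)) - z *\<^sub>C (c *\<^sub>C x) = c *\<^sub>C (the (T x) - z *\<^sub>C x)"
    and "x - y \<in> dom T" "the (T (x - y)) - z *\<^sub>C (x - y) = (the (T x) - z *\<^sub>C x) - (the (T y) - z *\<^sub>C y)"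
proof -
  have lin: "csubspace (dom T)"
    "\<And>x y. x \<in> dom T \<Longrightarrow> y \<in> dom T \<Longrightarrow> the (T (x + y)) = the (T x) + the (T y)"
    "\<And>c x. x \<in> dom T \<Longrightarrow> the (T (c *\<^sub>C x)) = c *\<^sub>C the (T x)"
    using assms(1) unfolding linear_op_def by blast+
  show "x + y \<in> dom T" by (rule complex_vector.subspace_add[OF lin(1) assms(2,3)])
  show "c *\<^sub>C x \<in> dom T" by (rule complex_vector.subspace_scale[OF lin(1) assms(2)])
  show xy: "x - y \<in> dom T" by (rule complex_vector.subspace_diff[OF lin(1) assms(2,3)])
  show "the (T (x + y)) - z *\<^sub>C (x + y) = (the (T x) - z *\<^sub>C x) + (the (T y) - z *\<^sub>C y)"
    using lin(2)[OF assms(2,3)] by (simp add: scaleC_add_right)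
  show "the (T (c *\<^sub>C x)) - z *\<^sub>C (c *\<^sub>C x) = c *\<^sub>C (the (T x) - z *\<^sub>C x)"
    using lin(3)[OF assms(2)]
    by (simp add: complex_vector.scale_right_diff_distrib scaleC_scaleC mult.commute)
  show "the (T (x - y)) - z *\<^sub>C (x - y) = (the (T x) - z *\<^sub>C x) - (the (T y) - z *\<^sub>C y)"
    using lin(2)[OF xy assms(3)] by (simp add: complex_vector.scale_right_diff_distrib)
qed

lemma csubspace_Rng_shift:
  assumes "linear_op T"
  shows "csubspace (Rng_shift T z)"
proof (rule complex_vector.subspaceI)
  have "(0::'a) \<in> dom T" using assms complex_vector.subspace_0 unfolding linear_op_def by blast
  moreover from this have "0 = the (T 0) - z *\<^sub>C 0"
    using linear_op_shift(4)[OF assms, where x = 0 and y = 0 and c = 0 and z = z] by simp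
  ultimately show "0 \<in> Rng_shift T z" unfolding Rng_shift_def by blast
next
  fix x y assume "x \<in> Rng_shift T z" "y \<in> Rng_shift T z"
  then obtain a b where ab: "a \<in> dom T" "b \<in> dom T"
    and xy: "x = the (T a) - z *\<^sub>C a" "y = the (T b) - z *\<^sub>C b"
    unfolding Rng_shift_def by blast
  show "x + y \<in> Rng_shift T z"
    unfolding xy linear_op_shift(2)[OF assms ab, symmetric] Rng_shift_def
    using linear_op_shift(1)[OF assms ab] by blast
next
  fix c x assume "x \<in> Rng_shift T z"
  then obtain a where a: "a \<in> dom T" and x: "x = the (T a) - z *\<^sub>C a"
    unfolding Rng_shift_def by blast
  show "c *\<^sub>C x \<in> Rng_shift T z"
    unfolding x linear_op_shift(4)[OF assms a a, symmetric] Rng_shift_def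
    using linear_op_shift(3)[OF assms a a] by blast
qed

text \<open>By the lower bound, preimages of a convergent sequence are Cauchy. Their limit solves
  the limiting equation weakly, and therefore belongs to the domain.\<close>

lemma closed_Rng_shift_selfadjoint:
  fixes T :: "'h::chilbert_space \<rightharpoonup> 'h"
  assumes T: "selfadjoint_op T" and z: "Im z \<noteq> 0"
  shows "closed (Rng_shift T z)"
  unfolding closed_sequential_limits
proof (intro allI impI, elim conjE)
  fix y l assume y: "\<forall>n. y n \<in> Rng_shift T z" and l: "y \<longlonglongrightarrow> l"
  have lin: "linear_op T" using T unfolding selfadjoint_op_def by blast
  have "\<forall>n. \<exists>x. x \<in> dom T \<and> y n = the (T x) - z *\<^sub>C x"
    using y unfolding Rng_shift_def by blast
  then obtain x where x: "\<And>n. x n \<in> dom T" and yx: "\<And>n. y n = the (T (x n)) - z *\<^sub>C x n"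
    by metis
  have est: "\<bar>Im z\<bar> * norm (x m - x n) \<le> norm (y m - y n)" for m n
    using selfadjoint_op_shift_bounded_below[OF T linear_op_shift(5)[OF lin x x], of z m n]
    unfolding yx linear_op_shift(6)[OF lin x x] .
  have "Cauchy x"
  proof (rule metric_CauchyI)
    fix e :: real assume "e > 0"
    then have "\<bar>Im z\<bar> * e > 0" using z by simp
    then obtain M where M: "\<And>m n. M \<le> m \<Longrightarrow> M \<le> n \<Longrightarrow> dist (y m) (y n) < \<bar>Im z\<bar> * e"
      using LIMSEQ_imp_Cauchy[OF l] metric_CauchyD by blast
    have "dist (x m) (x n) < e" if "M \<le> m" "M \<le> n" for m n
    proof -
      have "\<bar>Im z\<bar> * dist (x m) (x n) < \<bar>Im z\<bar> * e"
        using est[of m n] M[OF that] unfolding dist_norm by linarith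
      then show ?thesis using z by (simp add: mult_less_cancel_left_pos)
    qed
    then show "\<exists>M. \<forall>m\<ge>M. \<forall>n\<ge>M. dist (x m) (x n) < e" by blast
  qed
  then obtain p where p: "x \<longlonglongrightarrow> p" using Cauchy_convergent convergent_def by blast
  have Tx: "(\<lambda>n. the (T (x n))) \<longlonglongrightarrow> l + z *\<^sub>C p"
    using tendsto_add[OF l tendsto_scaleC[OF p, of z]] unfolding yx by simp
  have "cinner (the (T a)) p = cinner a (l + z *\<^sub>C p)" if "a \<in> dom T" for a
  proof (rule LIMSEQ_unique)
    show "(\<lambda>n. cinner (the (T a)) (x n)) \<longlonglongrightarrow> cinner (the (T a)) p"
      by (rule tendsto_cinner_right[OF p])
    show "(\<lambda>n. cinner (the (T a)) (x n)) \<longlonglongrightarrow> cinner a (l + z *\<^sub>C p)"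
      unfolding selfadjoint_op_symmetric[OF T that x] by (rule tendsto_cinner_right[OF Tx])
  qed
  then have "p \<in> dom T" "the (T p) = l + z *\<^sub>C p"
    using selfadjoint_op_domI[OF T] by blast+
  then have "p \<in> dom T" "l = the (T p) - z *\<^sub>C p" by simp_all
  then show "l \<in> Rng_shift T z" unfolding Rng_shift_def by blast
qed

text \<open>A vector orthogonal to the range would be an eigenvector for the nonreal number
  \<open>cnj z\<close> if it were nonzero, which the lower bound excludes.\<close>

lemma Rng_shift_selfadjoint:
  fixes T :: "'h::chilbert_space \<rightharpoonup> 'h"
  assumes T: "selfadjoint_op T" and z: "Im z \<noteq> 0"
  shows "Rng_shift T z = UNIV"
proof (rule closed_csubspace_eq_UNIV)
  show "csubspace (Rng_shift T z)"
    using T unfolding selfadjoint_op_def by (intro csubspace_Rng_shift) blast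
  show "closed (Rng_shift T z)" by (rule closed_Rng_shift_selfadjoint[OF T z])
  have "y = 0" if "y \<in> orth_compl (Rng_shift T z)" for y
  proof -
    have "cinner (the (T x)) y = cinner x (cnj z *\<^sub>C y)" if "x \<in> dom T" for x
    proof -
      have "cinner (the (T x) - z *\<^sub>C x) y = 0"
        using \<open>y \<in> _\<close> that unfolding orth_compl_def Rng_shift_def by blast
      then show ?thesis by (simp add: cinner_simps)
    qed
    then have "y \<in> dom T" "the (T y) = cnj z *\<^sub>C y"
      using selfadjoint_op_domI[OF T] by blast+
    then show ?thesis
      using selfadjoint_op_shift_bounded_below[OF T, of y "cnj z"] z
      by (simp add: mult_le_0_iff)
  qed
  moreover have "0 \<in> orth_compl (Rng_shift T z)" unfolding orth_compl_def by simp
  ultimately show "orth_compl (Rng_shift T z) = {0}" by blast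
qed

text \<open>Injectivity of T - z resolves the definite description. The algebra of resolvents below
  is reduced to that of T - z through this rule.\<close>

lemma resolvent_eqI:
  assumes T: "selfadjoint_op T" and z: "Im z \<noteq> 0" and x: "x \<in> dom T"
  shows "resolvent T z (the (T x) - z *\<^sub>C x) = x"
  unfolding resolvent_def
proof (rule the_equality)
  have lin: "linear_op T" using T unfolding selfadjoint_op_def by blast
  fix a assume a: "a \<in> dom T \<and> the (T a) - z *\<^sub>C a = the (T x) - z *\<^sub>C x"
  then have "the (T (a - x)) - z *\<^sub>C (a - x) = 0"
    using linear_op_shift(6)[OF lin _ x, of a z] by simp
  then show "a = x"
    using selfadjoint_op_shift_bounded_below[OF T linear_op_shift(5)[OF lin _ x], of a z] a z
    by (simp add: mult_le_0_iff)
qed (use x in simp)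

lemma resolvent_solves:
  fixes T :: "'h::chilbert_space \<rightharpoonup> 'h"
  assumes T: "selfadjoint_op T" and z: "Im z \<noteq> 0"
  shows "resolvent T z y \<in> dom T" "the (T (resolvent T z y)) - z *\<^sub>C resolvent T z y = y"
proof -
  obtain x where "x \<in> dom T" "y = the (T x) - z *\<^sub>C x"
    using Rng_shift_selfadjoint[OF T z] unfolding Rng_shift_def by blast
  then show "resolvent T z y \<in> dom T" "the (T (resolvent T z y)) - z *\<^sub>C resolvent T z y = y"
    using resolvent_eqI[OF T z] by simp_all
qed

lemma resolvent_add:
  fixes T :: "'h::chilbert_space \<rightharpoonup> 'h"
  assumes T: "selfadjoint_op T" and z: "Im z \<noteq> 0"
  shows "resolvent T z (x + y) = resolvent T z x + resolvent T z y"
proof -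
  have lin: "linear_op T" using T unfolding selfadjoint_op_def by blast
  note r = resolvent_solves[OF T z]
  show ?thesis
    using resolvent_eqI[OF T z linear_op_shift(1)[OF lin r(1) r(1)], of x y]
    unfolding linear_op_shift(2)[OF lin r(1) r(1)] r(2) .
qed

lemma resolvent_scaleC:
  fixes T :: "'h::chilbert_space \<rightharpoonup> 'h"
  assumes T: "selfadjoint_op T" and z: "Im z \<noteq> 0"
  shows "resolvent T z (c *\<^sub>C x) = c *\<^sub>C resolvent T z x"
proof -
  have lin: "linear_op T" using T unfolding selfadjoint_op_def by blast
  note r = resolvent_solves[OF T z]
  show ?thesis
    using resolvent_eqI[OF T z linear_op_shift(3)[OF lin r(1) r(1)], of c x]
    unfolding linear_op_shift(4)[OF lin r(1) r(1)] r(2) .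
qed

text \<open>Writing \<open>x\<close> as (T - z) a and \<open>y\<close> as (T - cnj z) b turns the
  claim into the symmetry of \<open>T\<close>.\<close>

lemma cinner_resolvent:
  fixes T :: "'h::chilbert_space \<rightharpoonup> 'h"
  assumes T: "selfadjoint_op T" and z: "Im z \<noteq> 0"
  shows "cinner (resolvent T z x) y = cinner x (resolvent T (cnj z) y)"
proof -
  define a where "a = resolvent T z x"
  define b where "b = resolvent T (cnj z) y"
  have a: "a \<in> dom T" "x = the (T a) - z *\<^sub>C a"
    and b: "b \<in> dom T" "y = the (T b) - cnj z *\<^sub>C b"
    unfolding a_def b_def using resolvent_solves[OF T] z by simp_all
  have "cinner a y = cinner x b"
    unfolding a(2) b(2) using selfadjoint_op_symmetric[OF T a(1) b(1)] by (simp add: cinner_simps)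
  then show ?thesis unfolding a_def b_def .
qed

lemma resolvent_identity:
  fixes T :: "'h::chilbert_space \<rightharpoonup> 'h"
  assumes T: "selfadjoint_op T" and z: "Im a \<noteq> 0" "Im b \<noteq> 0"
  shows "(a - b) *\<^sub>C resolvent T a (resolvent T b x) = resolvent T a x - resolvent T b x"
proof -
  define y where "y = resolvent T b x"
  have y: "y \<in> dom T" "x = the (T y) - b *\<^sub>C y"
    unfolding y_def using resolvent_solves[OF T z(2)] by simp_all
  \<comment> \<open>Applying the resolvent at \<open>a\<close> to this splitting of (T - b) y gives
    the identity.\<close>
  have x: "x = (the (T y) - a *\<^sub>C y) + (a - b) *\<^sub>C y"
    using y(2) by (simp add: complex_vector.scale_left_diff_distrib)
  have "resolvent T a x = y + (a - b) *\<^sub>C resolvent T a y"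
    by (subst x) (simp only: resolvent_add[OF T z(1)] resolvent_scaleC[OF T z(1)]
        resolvent_eqI[OF T z(1) y(1)])
  then show ?thesis unfolding y_def[symmetric] by simp
qed

section \<open>The cocycle of transfer operators between defect spaces\<close>

text \<open>The operator \<open>(T - b) (T - a)\<^sup>-\<^sup>1\<close>.\<close>

definition transfer_op :: "('h::complex_inner \<rightharpoonup> 'h) \<Rightarrow> complex \<Rightarrow> complex \<Rightarrow> 'h \<Rightarrow> 'h"
  where "transfer_op T a b x = x + (a - b) *\<^sub>C resolvent T a x"

lemma transfer_op_refl [simp]: "transfer_op T a a x = x"
  by (simp add: transfer_op_def)

lemma transfer_op_add:
  fixes T :: "'h::chilbert_space \<rightharpoonup> 'h"
  assumes "selfadjoint_op T" "Im a \<noteq> 0"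
  shows "transfer_op T a b (x + y) = transfer_op T a b x + transfer_op T a b y"
  by (simp add: transfer_op_def resolvent_add[OF assms] scaleC_add_right)

lemma transfer_op_scaleC:
  fixes T :: "'h::chilbert_space \<rightharpoonup> 'h"
  assumes "selfadjoint_op T" "Im a \<noteq> 0"
  shows "transfer_op T a b (c *\<^sub>C x) = c *\<^sub>C transfer_op T a b x"
  by (simp add: transfer_op_def resolvent_scaleC[OF assms] scaleC_add_right scaleC_scaleC mult.commute)

lemma transfer_op_sum:
  fixes T :: "'h::chilbert_space \<rightharpoonup> 'h"
  assumes "selfadjoint_op T" "Im a \<noteq> 0"
  shows "transfer_op T a b (\<Sum>i\<in>I. f i) = (\<Sum>i\<in>I. transfer_op T a b (f i))"
proof -
  have "transfer_op T a b 0 = 0" using transfer_op_add[OF assms, of b 0 0] by simp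
  then show ?thesis
    by (induction I rule: infinite_finite_induct) (auto simp: transfer_op_add[OF assms])
qed

text \<open>Formally the factors T - b cancel in the composite of (T - b)/(T - a) and (T - c)/(T -
  b); the first resolvent identity makes this precise.\<close>

lemma transfer_op_trans:
  fixes T :: "'h::chilbert_space \<rightharpoonup> 'h"
  assumes T: "selfadjoint_op T" and z: "Im a \<noteq> 0" "Im b \<noteq> 0"
  shows "transfer_op T a b (transfer_op T b c x) = transfer_op T a c x"
proof -
  let ?R = "resolvent T"
  have "transfer_op T a b (transfer_op T b c x)
      = (x + (b - c) *\<^sub>C ?R b x) + (a - b) *\<^sub>C ?R a x + (b - c) *\<^sub>C ((a - b) *\<^sub>C ?R a (?R b x))"
    unfolding transfer_op_def resolvent_add[OF T z(1)] resolvent_scaleC[OF T z(1)]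
    by (simp add: scaleC_add_right scaleC_scaleC mult.commute)
  also have "\<dots> = x + (a - c) *\<^sub>C ?R a x"
    unfolding resolvent_identity[OF T z]
    by (simp add: complex_vector.scale_right_diff_distrib complex_vector.scale_left_diff_distrib)
  finally show ?thesis unfolding transfer_op_def .
qed

lemma cinner_transfer_op:
  fixes T :: "'h::chilbert_space \<rightharpoonup> 'h"
  assumes "selfadjoint_op T" "Im a \<noteq> 0"
  shows "cinner (transfer_op T a b x) y = cinner x (transfer_op T (cnj a) (cnj b) y)"
  by (simp add: transfer_op_def cinner_simps cinner_resolvent[OF assms])

text \<open>The adjoint transfer sends (T - cnj a) x to (T - cnj b) x for \<open>x\<close> in
  \<open>dom T\<close>, because \<open>T'\<close> agrees with \<open>T\<close> there. Orthogonality
  to one range thus becomes orthogonality to the other.\<close>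

lemma transfer_op_orth_compl:
  fixes T T' :: "'h::chilbert_space \<rightharpoonup> 'h"
  assumes T': "selfadjoint_op T'" and sub: "T \<subseteq>\<^sub>m T'"
    and z: "Im a \<noteq> 0"
    and y: "y \<in> orth_compl (Rng_shift T (cnj b))"
  shows "transfer_op T' a b y \<in> orth_compl (Rng_shift T (cnj a))"
proof -
  have "cinner (the (T x) - cnj a *\<^sub>C x) (transfer_op T' a b y) = 0" if x: "x \<in> dom T" for x
  proof -
    have eq: "the (T' x) = the (T x)" and x': "x \<in> dom T'"
      using sub x map_le_implies_dom_le[OF sub] unfolding map_le_def by auto
    have "transfer_op T' (cnj a) (cnj b) (the (T x) - cnj a *\<^sub>C x) = the (T x) - cnj b *\<^sub>C x"
      using resolvent_eqI[OF T' _ x', of "cnj a"] z unfolding eq transfer_op_def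
      by (simp add: complex_vector.scale_left_diff_distrib)
    moreover have "cinner (the (T x) - cnj a *\<^sub>C x) (transfer_op T' a b y)
        = cinner (transfer_op T' (cnj a) (cnj b) (the (T x) - cnj a *\<^sub>C x)) y"
      using cinner_transfer_op[OF T', of "cnj a" "cnj b"] z by simp
    ultimately show ?thesis using y x unfolding orth_compl_def Rng_shift_def by auto
  qed
  then show ?thesis unfolding orth_compl_def Rng_shift_def by blast
qed

section \<open>Square roots of positive semidefinite matrices\<close>

lemma scaleC_vec_eq: "c *\<^sub>C x = c *s (x :: complex^'n)"
  by (simp add: scaleC_vec_def vector_scalar_mult_def scaleC_complex_def)

lemma matrix_vector_mult_scaleC: "M *v (c *\<^sub>C x) = c *\<^sub>C (M *v x)"
  for M :: "complex^'n^'m"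
  by (simp add: scaleC_vec_eq vec.scale)

lemma cinner_vec_eq: "cinner x y = (\<Sum>i\<in>UNIV. x $ i * cnj (y $ i))" for x y :: "complex^'n"
  by (simp add: cinner_vec_def cinner_complex_def)

text \<open>Relates complex orthogonality to the real notion, so that orthonormal sets are
  independent over the reals.\<close>

lemma inner_eq_Re_cinner: "x \<bullet> y = Re (cinner x y)" for x y :: "complex^'n"
  by (simp add: inner_vec_def cinner_vec_eq inner_complex_def)

lemma cinner_adjoint_matrix: "cinner (M *v x) y = cinner x (adjoint_matrix M *v y)"
  for M :: "complex^'n^'m"
proof -
  have "cinner (M *v x) y = (\<Sum>i\<in>UNIV. \<Sum>j\<in>UNIV. M $ i $ j * x $ j * cnj (y $ i))"
    by (simp add: cinner_vec_eq matrix_vector_mult_def sum_distrib_right)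
  also have "\<dots> = (\<Sum>j\<in>UNIV. \<Sum>i\<in>UNIV. M $ i $ j * x $ j * cnj (y $ i))"
    by (rule sum.swap)
  also have "\<dots> = cinner x (adjoint_matrix M *v y)"
    by (simp add: cinner_vec_eq matrix_vector_mult_def adjoint_matrix_def sum_distrib_left ac_simps)
  finally show ?thesis .
qed

lemma adjoint_matrix_mult: "adjoint_matrix (A ** B) = adjoint_matrix B ** adjoint_matrix A"
  by (simp add: vec_eq_iff adjoint_matrix_def matrix_matrix_mult_def mult.commute)

lemma adjoint_matrix_mat_1 [simp]: "adjoint_matrix (mat 1) = mat 1"
  by (simp add: vec_eq_iff adjoint_matrix_def mat_def)

lemma cinner_axis_1: "cinner x (axis i 1) = x $ i" for x :: "complex^'n"
  by (simp add: cinner_vec_eq axis_def if_distrib[of cnj] if_distrib[of "\<lambda>c. _ * c"] cong: if_cong)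

text \<open>Polarization: reality of the form at \<open>x + y\<close> and at
  \<open>x + \<i> *\<^sub>C y\<close> controls the imaginary and the real parts of \<open>a\<close>
  and \<open>b\<close>.\<close>

lemma pos_semidef_hermitian:
  assumes "pos_semidef M"
  shows "cinner (M *v x) y = cinner x (M *v y)"
proof -
  define a where "a = cinner (M *v x) y"
  define b where "b = cinner (M *v y) x"
  have im: "Im (cinner (M *v v) v) = 0" for v
    using assms unfolding pos_semidef_def by (auto simp: complex_nonneg_Reals_iff)
  have "Im (a + b) = 0"
    using im[of "x + y"] im[of x] im[of y]
    by (simp add: a_def b_def matrix_vector_right_distrib cinner_simps)
  moreover have "Re a = Re b"
    using im[of "x + \<i> *\<^sub>C y"] im[of x] im[of y]
    by (simp add: a_def b_def matrix_vector_right_distrib matrix_vector_mult_scaleC cinner_simps)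
  ultimately have "a = cnj b" by (simp add: complex_eq_iff)
  then show ?thesis unfolding a_def b_def cinner_commute[of x "M *v y"] .
qed

lemma pos_semidef_adjoint_matrix:
  assumes "pos_semidef M"
  shows "adjoint_matrix M = M"
proof -
  have "(adjoint_matrix M *v x) $ i = (M *v x) $ i" for x i
    using cinner_adjoint_matrix[of M "axis i 1" x] pos_semidef_hermitian[OF assms, of "axis i 1" x]
      cinner_axis_1[of "adjoint_matrix M *v x" i] cinner_axis_1[of "M *v x" i]
      cinner_commute[of "axis i 1" "adjoint_matrix M *v x"] cinner_commute[of "axis i 1" "M *v x"]
    by (metis complex_cnj_cancel_iff)
  then show ?thesis by (simp add: matrix_eq vec_eq_iff)
qed

section \<open>Spectral theorem for Hermitian matrices\<close>

text \<open>A maximiser of the quadratic form on the unit sphere is an eigenvector.\<close>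

lemma hermitian_eigenvector_exists:
  fixes M :: "complex^'n^'n"
  assumes herm: "\<And>x y. cinner (M *v x) y = cinner x (M *v y)"
    and U: "csubspace U" and inv: "\<And>x. x \<in> U \<Longrightarrow> M *v x \<in> U" and nz: "w \<in> U" "w \<noteq> 0"
  obtains x m where "x \<in> U" "norm x = 1" "M *v x = complex_of_real m *\<^sub>C x"
proof -
  define f where "f x = Re (cinner (M *v x) x)" for x
  define K where "K = U \<inter> sphere 0 1"
  have sub: "subspace U"
    using U by (auto simp: subspace_def complex_vector.subspace_0 complex_vector.subspace_add
        complex_vector.subspace_scale scaleR_eq_scaleC)
  have scale: "c *\<^sub>C x \<in> U" if "x \<in> U" for c x
    using U that by (rule complex_vector.subspace_scale)
  have "compact K"
    unfolding K_def by (intro closed_Int_compact closed_subspace sub compact_sphere)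
  moreover have normalize: "complex_of_real (1 / norm y) *\<^sub>C y \<in> K" if "y \<in> U" "y \<noteq> 0" for y
    unfolding K_def using that by (simp add: scale norm_scaleC norm_divide)
  then have "K \<noteq> {}" using nz by blast
  moreover have "continuous_on K f"
    unfolding f_def cinner_vec_eq matrix_vector_mult_def
    by (simp, intro continuous_intros)
  ultimately obtain x where x: "x \<in> K" and max: "\<And>y. y \<in> K \<Longrightarrow> f y \<le> f x"
    using continuous_attains_sup[of K f] by blast
  define m where "m = f x"
  \<comment> \<open>The form of \<open>N\<close> is nonnegative on \<open>U\<close> and vanishes at
    \<open>x\<close>. Varying \<open>x\<close> in the direction \<open>N x\<close> shows that
    \<open>N x\<close> is zero.\<close>
  define N where "N y = complex_of_real m *\<^sub>C y - M *v y" for y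
  have xU: "x \<in> U" and nx: "norm x = 1" using x unfolding K_def by auto
  have f_scale: "f (complex_of_real r *\<^sub>C y) = r\<^sup>2 * f y" for r y
    by (simp add: f_def matrix_vector_mult_scaleC cinner_simps power2_eq_square)
  have bound: "f y \<le> m * (norm y)\<^sup>2" if "y \<in> U" for y
  proof (cases "y = 0")
    case True then show ?thesis by (simp add: f_def)
  next
    case False
    then have "(1 / norm y)\<^sup>2 * f y \<le> m"
      using max[OF normalize[OF that False]] unfolding f_scale m_def by simp
    with False show ?thesis by (simp add: field_simps)
  qed
  have N_form: "Re (cinner (N y) y) = m * (norm y)\<^sup>2 - f y" for y
    by (simp add: N_def f_def cinner_simps cinner_self)
  have N_herm: "cinner (N y) z = cinner y (N z)" for y z
    by (simp add: N_def cinner_simps herm)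
  have N_add: "N (y + z) = N y + N z" and N_scale: "N (c *\<^sub>C y) = c *\<^sub>C N y" for y z c
    by (simp_all add: N_def matrix_vector_right_distrib matrix_vector_mult_scaleC scaleC_add_right
        scaleC_scaleC mult.commute complex_vector.scale_right_diff_distrib)
  define v where "v = N x"
  have vU: "v \<in> U"
    unfolding v_def N_def using U xU by (intro complex_vector.subspace_diff scale inv)
  define b where "b = Re (cinner (N v) v)"
  have Nx: "Re (cinner (N x) x) = 0" unfolding N_form m_def using nx by simp
  have quad: "0 \<le> 2 * t * (norm v)\<^sup>2 + t\<^sup>2 * b" for t
  proof -
    let ?y = "x + complex_of_real t *\<^sub>C v"
    have "?y \<in> U" using U xU vU by (intro complex_vector.subspace_add scale)
    then have "0 \<le> Re (cinner (N ?y) ?y)" using bound N_form by simp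
    also have "\<dots> = Re (cinner (N x) x) + t * Re (cinner (N x) v) + t * Re (cinner (N v) x) + t\<^sup>2 * b"
      by (simp add: N_add N_scale cinner_simps b_def power2_eq_square algebra_simps)
    also have "\<dots> = 2 * t * (norm v)\<^sup>2 + t\<^sup>2 * b"
      unfolding N_herm[of v x] v_def[symmetric] using Nx[folded v_def] by (simp add: Re_cinner_self)
    finally show ?thesis .
  qed
  have "v = 0"
  proof (rule ccontr)
    assume "v \<noteq> 0"
    define s where "s = (norm v)\<^sup>2"
    have s: "s > 0" using \<open>v \<noteq> 0\<close> by (simp add: s_def)
    \<comment> \<open>At \<open>- t\<close> the linear term of \<open>quad\<close> outweighs the
      quadratic one; the summand 1 keeps the denominator positive.\<close>
    define t where "t = s / (\<bar>b\<bar> + 1)"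
    have t: "t > 0" "t * (\<bar>b\<bar> + 1) = s" using s by (simp_all add: t_def)
    have "0 \<le> 2 * (- t) * s + t\<^sup>2 * b" using quad[of "- t"] unfolding s_def by simp
    also have "\<dots> = t * (t * b - 2 * s)" by (simp add: power2_eq_square algebra_simps)
    finally have "2 * s \<le> t * b" using t(1) by (simp add: zero_le_mult_iff)
    also have "\<dots> \<le> t * (\<bar>b\<bar> + 1)" using t(1) by (intro mult_left_mono) auto
    finally show False using t(2) s by simp
  qed
  then have "M *v x = complex_of_real m *\<^sub>C x" unfolding v_def N_def by simp
  with xU nx show ?thesis by (rule that)
qed

text \<open>An orthonormal set of eigenvectors of maximal size works: its orthogonal complement is
  invariant, so a nonzero vector there would produce one more eigenvector.\<close>

lemma hermitian_orthonormal_eigenbasis: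
  fixes M :: "complex^'n^'n"
  assumes herm: "\<And>x y. cinner (M *v x) y = cinner x (M *v y)"
  obtains E \<mu> where "finite E" "\<And>e f. e \<in> E \<Longrightarrow> f \<in> E \<Longrightarrow> cinner e f = (if e = f then 1 else 0)"
    "\<And>e. e \<in> E \<Longrightarrow> M *v e = complex_of_real (\<mu> e) *\<^sub>C e"
    "\<And>x. x = (\<Sum>e\<in>E. cinner x e *\<^sub>C e)"
proof -
  define P where "P E \<longleftrightarrow> finite E \<and>
    (\<forall>e\<in>E. \<forall>f\<in>E. cinner e f = (if e = f then 1 else 0)) \<and>
    (\<forall>e\<in>E. \<exists>m. M *v e = complex_of_real m *\<^sub>C e)" for E
  \<comment> \<open>Independence over the reals bounds the sizes by the real dimension, which
    suffices for a maximum to exist.\<close>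
  have "card E < Suc DIM(complex^'n)" if "P E" for E
  proof -
    have "pairwise orthogonal E"
      using that by (auto simp: P_def pairwise_def orthogonal_def inner_eq_Re_cinner)
    moreover have "cinner e e = 1" if "e \<in> E" for e using that \<open>P E\<close> by (simp add: P_def)
    then have "0 \<notin> E" by fastforce
    ultimately have "independent E" by (rule pairwise_orthogonal_independent)
    then have "card E \<le> DIM(complex^'n)" using independent_bound by blast
    then show ?thesis by simp
  qed
  moreover have "P {}" by (simp add: P_def)
  ultimately obtain E where E: "P E" and max: "\<And>F. P F \<Longrightarrow> card F \<le> card E"
    using ex_has_greatest_nat[of P "{}" card "Suc DIM(complex^'n)"] less_imp_le by metis
  have fin: "finite E" and on: "\<And>e f. e \<in> E \<Longrightarrow> f \<in> E \<Longrightarrow> cinner e f = (if e = f then 1 else 0)"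
    using E unfolding P_def by blast+
  obtain \<mu> where \<mu>: "\<And>e. e \<in> E \<Longrightarrow> M *v e = complex_of_real (\<mu> e) *\<^sub>C e"
    using E unfolding P_def by metis
  have sub: "csubspace (orth_compl E)"
    by (auto simp: complex_vector.subspace_def orth_compl_def cinner_simps)
  have inv: "M *v x \<in> orth_compl E" if "x \<in> orth_compl E" for x
    using that \<mu> unfolding orth_compl_def by (auto simp: herm[symmetric] cinner_simps)
  have zero: "w = 0" if w: "w \<in> orth_compl E" for w
  proof (rule ccontr)
    assume "w \<noteq> 0"
    obtain x m where x: "x \<in> orth_compl E" "norm x = 1" "M *v x = complex_of_real m *\<^sub>C x"
      using hermitian_eigenvector_exists[OF herm sub inv w \<open>w \<noteq> 0\<close>] by blast
    have xx: "cinner x x = 1" using x(2) by (simp add: cinner_self)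
    have ex: "cinner e x = 0" "cinner x e = 0" if "e \<in> E" for e
      using x(1) that cinner_commute[of x e] unfolding orth_compl_def by auto
    have "x \<notin> E" using ex xx by auto
    moreover have "P (insert x E)"
      using fin on \<mu> x(3) xx ex \<open>x \<notin> E\<close> unfolding P_def by auto
    ultimately show False using max[of "insert x E"] fin by simp
  qed
  have "x = (\<Sum>e\<in>E. cinner x e *\<^sub>C e)" for x
  proof -
    have "cinner f (x - (\<Sum>e\<in>E. cinner x e *\<^sub>C e)) = 0" if "f \<in> E" for f
    proof -
      have "cinner f (\<Sum>e\<in>E. cinner x e *\<^sub>C e) = (\<Sum>e\<in>E. if e = f then cnj (cinner x e) else 0)"
        unfolding cinner_sum_right using on that by (intro sum.cong) (auto simp: cinner_scaleC_right)
      also have "\<dots> = cinner f x" using fin that cinner_commute[of f x] by simp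
      finally show ?thesis by (simp add: cinner_diff_right)
    qed
    then show ?thesis using zero[of "x - (\<Sum>e\<in>E. cinner x e *\<^sub>C e)"] unfolding orth_compl_def by auto
  qed
  with fin on \<mu> show ?thesis by (rule that)
qed

section \<open>Existence and uniqueness of the positive square root\<close>

lemma pos_semidef_eigenvalue_nonneg:
  assumes "pos_semidef M" "M *v e = complex_of_real m *\<^sub>C e" "cinner e e = 1"
  shows "0 \<le> m"
proof -
  have "cinner (M *v e) e = complex_of_real m"
    using assms(2,3) by (simp add: cinner_scaleC_left)
  then show ?thesis
    using assms(1) nonneg_Reals_of_real_iff[of m] unfolding pos_semidef_def by metis
qed

lemma pos_semidef_sqrt_exists:
  fixes M :: "complex^'n^'n"
  assumes M: "pos_semidef M"
  obtains S where "pos_semidef S" "S ** S = M"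
proof -
  obtain E \<mu> where fin: "finite E"
    and on: "\<And>e f. e \<in> E \<Longrightarrow> f \<in> E \<Longrightarrow> cinner e f = (if e = f then 1 else 0)"
    and \<mu>: "\<And>e. e \<in> E \<Longrightarrow> M *v e = complex_of_real (\<mu> e) *\<^sub>C e"
    and expand: "\<And>x. x = (\<Sum>e\<in>E. cinner x e *\<^sub>C e)"
    using hermitian_orthonormal_eigenbasis[of M, OF pos_semidef_hermitian[OF M]] by blast
  have nonneg: "0 \<le> \<mu> e" if "e \<in> E" for e
    using pos_semidef_eigenvalue_nonneg[OF M \<mu>[OF that]] on[OF that that] by simp
  \<comment> \<open>The sum of the rank-one projections onto the eigenvectors, weighted by the roots
    of the eigenvalues.\<close>
  define S :: "complex^'n^'n" where
    "S = (\<chi> k j. \<Sum>e\<in>E. complex_of_real (sqrt (\<mu> e)) * e $ k * cnj (e $ j))"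
  have S: "S *v x = (\<Sum>e\<in>E. (complex_of_real (sqrt (\<mu> e)) * cinner x e) *\<^sub>C e)" for x
  proof -
    have "(S *v x) $ k = (\<Sum>j\<in>UNIV. \<Sum>e\<in>E. complex_of_real (sqrt (\<mu> e)) * e $ k * cnj (e $ j) * x $ j)" for k
      by (simp add: S_def matrix_vector_mult_def sum_distrib_right)
    moreover have "\<dots> k = (\<Sum>e\<in>E. \<Sum>j\<in>UNIV. complex_of_real (sqrt (\<mu> e)) * e $ k * cnj (e $ j) * x $ j)" for k
      by (rule sum.swap)
    moreover have "\<dots> k = (\<Sum>e\<in>E. (complex_of_real (sqrt (\<mu> e)) * cinner x e) *\<^sub>C e) $ k" for k
      by (simp add: cinner_vec_eq scaleC_vec_eq sum_distrib_left sum_distrib_right ac_simps)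
    ultimately show ?thesis by (simp add: vec_eq_iff)
  qed
  have Se: "S *v f = complex_of_real (sqrt (\<mu> f)) *\<^sub>C f" if "f \<in> E" for f
  proof -
    have "S *v f = (\<Sum>e\<in>E. if e = f then complex_of_real (sqrt (\<mu> e)) *\<^sub>C e else 0)"
      unfolding S using on[OF that] by (intro sum.cong) auto
    then show ?thesis using fin that by simp
  qed
  have lin: "A *v x = (\<Sum>e\<in>E. cinner x e *\<^sub>C (A *v e))" for A :: "complex^'n^'n" and x
    using arg_cong[OF expand[of x], of "(*v) A"] by (simp add: vec.sum matrix_vector_mult_scaleC)
  have "(S ** S) *v x = M *v x" for x
    unfolding matrix_vector_mul_assoc[symmetric] lin[of M x] lin[of S x] vec.sum
      matrix_vector_mult_scaleC
    by (intro sum.cong refl) (use nonneg in \<open>simp add: Se \<mu> matrix_vector_mult_scaleC scaleC_scaleC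
        flip: of_real_mult\<close>)
  then have "S ** S = M" by (simp add: matrix_eq)
  moreover have "cinner (S *v x) x = complex_of_real (\<Sum>e\<in>E. sqrt (\<mu> e) * (cmod (cinner x e))\<^sup>2)" for x
  proof -
    have "cinner ((complex_of_real (sqrt (\<mu> e)) * cinner x e) *\<^sub>C e) x
        = complex_of_real (sqrt (\<mu> e) * (cmod (cinner x e))\<^sup>2)" for e
      using complex_norm_square[of "cinner x e"] cinner_commute[of e x]
      by (simp add: cinner_scaleC_left)
    then show ?thesis by (simp only: S cinner_sum_left of_real_sum)
  qed
  then have "pos_semidef S"
    unfolding pos_semidef_def using nonneg
    by (simp add: sum_nonneg del: of_real_sum of_real_mult of_real_power)
  ultimately show ?thesis using that by blast
qed

text \<open>For positive \<open>m\<close> with root r, the vector (S - r) e is annihilated by S + r;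
  it vanishes because \<open>S\<close> has no negative eigenvalue. This fixes a square root on an
  eigenbasis.\<close>

lemma pos_semidef_sqrt_eigenvector:
  fixes S :: "complex^'n^'n"
  assumes S: "pos_semidef S" and e: "(S ** S) *v e = complex_of_real m *\<^sub>C e" and m: "0 \<le> m"
  shows "S *v e = complex_of_real (sqrt m) *\<^sub>C e"
proof (cases "m = 0")
  case True
  have "cinner (S *v e) (S *v e) = cinner ((S ** S) *v e) e"
    by (simp add: pos_semidef_hermitian[OF S] flip: matrix_vector_mul_assoc)
  then show ?thesis using e True by (simp add: cinner_self_eq_zero)
next
  case False
  define r where "r = sqrt m"
  have r: "r > 0" "r\<^sup>2 = m" using m False by (simp_all add: r_def)
  define v where "v = S *v e - complex_of_real r *\<^sub>C e"
  have "S *v v = - (complex_of_real r *\<^sub>C v)"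
    using e r(2) by (simp add: v_def matrix_vector_mult_diff_distrib matrix_vector_mul_assoc
        matrix_vector_mult_scaleC complex_vector.scale_right_diff_distrib scaleC_scaleC
        power2_eq_square flip: of_real_mult)
  then have "cinner (S *v v) v = complex_of_real (- r * (norm v)\<^sup>2)"
    by (simp add: cinner_simps cinner_self)
  then have "0 \<le> - r * (norm v)\<^sup>2"
    using S unfolding pos_semidef_def by (metis nonneg_Reals_of_real_iff)
  then have "v = 0" using r(1) by (simp add: mult_le_0_iff)
  then show ?thesis by (simp add: v_def r_def)
qed

text \<open>Two positive semidefinite roots agree on an eigenbasis of \<open>M\<close>, so the
  definite description denotes the root constructed above.\<close>

lemma matrix_sqrt:
  fixes M :: "complex^'n^'n"
  assumes M: "pos_semidef M"
  shows "pos_semidef (matrix_sqrt M)" "matrix_sqrt M ** matrix_sqrt M = M"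
proof -
  have uniq: "S = S'"
    if S: "pos_semidef S" "S ** S = M" and S': "pos_semidef S'" "S' ** S' = M" for S S'
  proof -
    obtain E \<mu> where "finite E"
      and on: "\<And>e f. e \<in> E \<Longrightarrow> f \<in> E \<Longrightarrow> cinner e f = (if e = f then 1 else 0)"
      and \<mu>: "\<And>e. e \<in> E \<Longrightarrow> M *v e = complex_of_real (\<mu> e) *\<^sub>C e"
      and expand: "\<And>x. x = (\<Sum>e\<in>E. cinner x e *\<^sub>C e)"
      using hermitian_orthonormal_eigenbasis[of M, OF pos_semidef_hermitian[OF M]] by blast
    have lin: "A *v x = (\<Sum>e\<in>E. cinner x e *\<^sub>C (A *v e))" for A :: "complex^'n^'n" and x
      using arg_cong[OF expand[of x], of "(*v) A"] by (simp add: vec.sum matrix_vector_mult_scaleC)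
    have nonneg: "0 \<le> \<mu> e" if "e \<in> E" for e
      using pos_semidef_eigenvalue_nonneg[OF M \<mu>[OF that]] on[OF that that] by simp
    have "S *v e = S' *v e" if "e \<in> E" for e
      using pos_semidef_sqrt_eigenvector[OF S(1) _ nonneg[OF that]]
        pos_semidef_sqrt_eigenvector[OF S'(1) _ nonneg[OF that]] \<mu>[OF that]
      unfolding S(2) S'(2) by simp
    then have "S *v x = S' *v x" for x
      unfolding lin[of S x] lin[of S' x] by (intro sum.cong) auto
    then show ?thesis by (simp add: matrix_eq)
  qed
  obtain S where S: "pos_semidef S" "S ** S = M" using pos_semidef_sqrt_exists[OF M] by blast
  have "pos_semidef (matrix_sqrt M) \<and> matrix_sqrt M ** matrix_sqrt M = M"
    unfolding matrix_sqrt_def by (rule theI2[where a = S]) (use S uniq in blast)+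
  then show "pos_semidef (matrix_sqrt M)" "matrix_sqrt M ** matrix_sqrt M = M" by blast+
qed

section \<open>Matrices of inner products\<close>

text \<open>The sums over the whole index type already form a subspace containing the family. This
  indexing lets coefficients become matrix columns.\<close>

lemma mem_cspan_range_expansion:
  fixes u :: "'n::finite \<Rightarrow> 'h::complex_inner"
  assumes "x \<in> cspan (range u)"
  obtains c where "x = (\<Sum>l\<in>UNIV. c l *\<^sub>C u l)"
proof -
  let ?S = "range (\<lambda>c. \<Sum>l\<in>UNIV. c l *\<^sub>C u l)"
  have "csubspace ?S"
  proof (rule complex_vector.subspaceI)
    show "0 \<in> ?S" by (rule image_eqI[of _ _ "\<lambda>_. 0"]) auto
  next
    fix x y assume "x \<in> ?S" "y \<in> ?S"
    then obtain c d where "x = (\<Sum>l\<in>UNIV. c l *\<^sub>C u l)" "y = (\<Sum>l\<in>UNIV. d l *\<^sub>C u l)" by blast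
    then have "x + y = (\<Sum>l\<in>UNIV. (c l + d l) *\<^sub>C u l)"
      by (simp add: scaleC_add_left sum.distrib)
    then show "x + y \<in> ?S" by (intro image_eqI[of _ _ "\<lambda>l. c l + d l"]) simp_all
  next
    fix a x assume "x \<in> ?S"
    then obtain c where "x = (\<Sum>l\<in>UNIV. c l *\<^sub>C u l)" by blast
    then have "a *\<^sub>C x = (\<Sum>l\<in>UNIV. (a * c l) *\<^sub>C u l)"
      by (simp add: complex_vector.scale_sum_right scaleC_scaleC)
    then show "a *\<^sub>C x \<in> ?S" by (intro image_eqI[of _ _ "\<lambda>l. a * c l"]) simp_all
  qed
  moreover have "range u \<subseteq> ?S"
  proof (rule image_subsetI)
    fix j
    have "u j = (\<Sum>l\<in>UNIV. if l = j then u l else 0)" by simp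
    also have "\<dots> = (\<Sum>l\<in>UNIV. (if l = j then 1 else 0) *\<^sub>C u l)"
      by (intro sum.cong) (auto simp: scaleC_one)
    finally show "u j \<in> ?S" by (intro image_eqI[of _ _ "\<lambda>l. if l = j then 1 else 0"]) simp_all
  qed
  ultimately have "cspan (range u) \<subseteq> ?S" by (rule complex_vector.span_minimal[rotated])
  with assms that show ?thesis by blast
qed

definition lin_comb :: "('n::finite \<Rightarrow> 'h::complex_inner) \<Rightarrow> complex^'m^'n \<Rightarrow> 'm \<Rightarrow> 'h"
  where "lin_comb f C j = (\<Sum>l\<in>UNIV. C $ l $ j *\<^sub>C f l)"

text \<open>Columns follow the first family and rows the second, as in \<open>livsic_A\<close> and
  \<open>livsic_B\<close>.\<close>

definition cross_gram :: "('m \<Rightarrow> 'h::complex_inner) \<Rightarrow> ('n \<Rightarrow> 'h) \<Rightarrow> complex^'m^'n"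
  where "cross_gram f g = (\<chi> k j. cinner (f j) (g k))"

lemma cross_gram_lin_comb_left: "cross_gram (lin_comb f C) g = cross_gram f g ** C"
  by (simp add: cross_gram_def lin_comb_def matrix_matrix_mult_def vec_eq_iff cinner_sum_left
      cinner_scaleC_left mult.commute)

lemma cross_gram_lin_comb_right: "cross_gram f (lin_comb g C) = adjoint_matrix C ** cross_gram f g"
  by (simp add: cross_gram_def lin_comb_def matrix_matrix_mult_def vec_eq_iff cinner_sum_right
      cinner_scaleC_right adjoint_matrix_def)

section \<open>Kernel matrices of a model\<close>

lemma bounded_clinear_expansion:
  fixes A :: "complex^'n \<Rightarrow> 'h::complex_inner"
  assumes "bounded_clinear A"
  shows "A x = (\<Sum>k\<in>UNIV. x $ k *\<^sub>C A (axis k 1))"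
proof -
  have lin: "linear A" and scale: "\<And>c y. A (c *\<^sub>C y) = c *\<^sub>C A y"
    using assms unfolding bounded_clinear_def by (auto simp: bounded_linear.linear)
  have "A x = A (\<Sum>k\<in>UNIV. x $ k *\<^sub>C axis k 1)" by (simp add: scaleC_vec_eq basis_expansion)
  also have "\<dots> = (\<Sum>k\<in>UNIV. x $ k *\<^sub>C A (axis k 1))" by (simp add: linear_sum[OF lin] scale)
  finally show ?thesis .
qed

text \<open>The inner products with the images of the standard basis define an adjoint, and adjoints
  are unique, which resolves the definite description.\<close>

lemma cadjoint_component:
  fixes A :: "complex^'n \<Rightarrow> 'h::complex_inner"
  assumes A: "bounded_clinear A"
  shows "cadjoint A y $ k = cinner y (A (axis k 1))"
proof -
  define B where "B y = (\<chi> k. cinner y (A (axis k 1)))" for y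
  have B: "cinner (A x) y = cinner x (B y)" for x y
    unfolding B_def bounded_clinear_expansion[OF A, of x]
    by (simp add: cinner_sum_left cinner_scaleC_left cinner_vec_eq cinner_commute[of "A _" y])
  have "cadjoint A = B"
    unfolding cadjoint_def
  proof (rule the_equality)
    fix C assume C: "\<forall>x y. cinner (A x) y = cinner x (C y)"
    have "cinner (C y - B y) (C y - B y) = 0" for y
      using C B by (simp add: cinner_diff_right)
    then show "C = B" by (simp add: cinner_self_eq_zero fun_eq_iff)
  qed (use B in blast)
  then show ?thesis by (simp add: B_def)
qed

lemma model_kernel_component:
  fixes \<Gamma> :: "complex \<Rightarrow> complex^'n \<Rightarrow> 'h::complex_inner"
  assumes "bounded_clinear (\<Gamma> z)"
  shows "model_kernel \<Gamma> l z x $ k = cinner (\<Gamma> l x) (\<Gamma> z (axis k 1))"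
  by (simp add: model_kernel_def cadjoint_component[OF assms])

lemma kernel_matrix_eq_cross_gram:
  fixes \<Gamma> :: "complex \<Rightarrow> complex^'n \<Rightarrow> 'h::complex_inner"
  assumes "bounded_clinear (\<Gamma> z)"
  shows "kernel_matrix \<Gamma> l z = cross_gram (\<lambda>j. \<Gamma> l (axis j 1)) (\<lambda>k. \<Gamma> z (axis k 1))"
  by (simp add: kernel_matrix_def matrix_def cross_gram_def model_kernel_component[of \<Gamma> z, OF assms])

lemma kernel_matrix_vector_mult:
  fixes \<Gamma> :: "complex \<Rightarrow> complex^'n \<Rightarrow> 'h::complex_inner"
  assumes "bounded_clinear (\<Gamma> l)" "bounded_clinear (\<Gamma> z)"
  shows "kernel_matrix \<Gamma> l z *v x = model_kernel \<Gamma> l z x"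
proof -
  have "model_kernel \<Gamma> l z x $ k = (kernel_matrix \<Gamma> l z *v x) $ k" for k
    unfolding model_kernel_component[of \<Gamma> z, OF assms(2)] bounded_clinear_expansion[of "\<Gamma> l" x, OF assms(1)]
    by (simp add: kernel_matrix_def matrix_def matrix_vector_mult_def model_kernel_component[of \<Gamma> z, OF assms(2)]
        cinner_sum_left cinner_scaleC_left mult.commute)
  then show ?thesis by (simp add: vec_eq_iff)
qed

lemma invertible_kernel_matrix:
  fixes \<Gamma> :: "complex \<Rightarrow> complex^'n \<Rightarrow> 'h::complex_inner"
  assumes "bounded_clinear (\<Gamma> l)" "bounded_clinear (\<Gamma> z)" "bij (model_kernel \<Gamma> l z)"
  shows "invertible (kernel_matrix \<Gamma> l z)"
proof -
  have "(*v) (kernel_matrix \<Gamma> l z) = model_kernel \<Gamma> l z"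
    using kernel_matrix_vector_mult[of \<Gamma> l z, OF assms(1,2)] by blast
  then show ?thesis using assms(3) by (simp add: invertible_eq_bij)
qed

section \<open>Inverses and unitary factors\<close>

lemma matrix_inv_inverse:
  fixes A :: "complex^'n^'n"
  assumes "invertible A"
  shows "matrix_inv A ** A = mat 1" "A ** matrix_inv A = mat 1"
  using assms someI_ex[of "\<lambda>A'. A ** A' = mat 1 \<and> A' ** A = mat 1"]
  unfolding invertible_def matrix_inv_def by auto

lemma matrix_inv_eqI:
  fixes A B :: "complex^'n^'n"
  assumes "A ** B = mat 1"
  shows "matrix_inv A = B"
proof -
  have "invertible A" using assms invertible_right_inverse by blast
  then have "matrix_inv A ** (A ** B) = B"
    by (simp add: matrix_mul_assoc matrix_inv_inverse)
  then show ?thesis using assms by simp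
qed

lemma invertible_mult_right_factor:
  fixes A B :: "complex^'n^'n"
  assumes "invertible (A ** B)"
  shows "invertible B"
  using assms unfolding invertible_left_inverse by (metis matrix_mul_assoc)

lemma invertible_mult_left_factor:
  fixes A B :: "complex^'n^'n"
  assumes "invertible (A ** B)"
  shows "invertible A"
  using assms unfolding invertible_right_inverse by (metis matrix_mul_assoc)

lemma unitary_matrixI:
  fixes P :: "complex^'n^'n"
  assumes "adjoint_matrix P ** P = mat 1"
  shows "unitary_matrix P"
  using assms matrix_left_right_inverse unfolding unitary_matrix_def by blast

lemma adjoint_adjoint_matrix [simp]: "adjoint_matrix (adjoint_matrix P) = P"
  by (simp add: adjoint_matrix_def vec_eq_iff)

lemma unitary_adjoint_matrix: "unitary_matrix P \<Longrightarrow> unitary_matrix (adjoint_matrix P)"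
  unfolding unitary_matrix_def by simp

text \<open>This is the unitary factor in the polar decomposition of \<open>G\<close>: the inverse
  root of \<open>M\<close>, placed on both sides of \<open>M\<close>, gives the identity.\<close>

lemma unitary_polar_factor:
  fixes G :: "complex^'n^'n"
  assumes M: "M = adjoint_matrix G ** G" and inv: "invertible M"
  shows "unitary_matrix (G ** matrix_inv_sqrt M)"
proof -
  define S where "S = matrix_sqrt M"
  have "cinner (M *v x) x = complex_of_real ((norm (G *v x))\<^sup>2)" for x
    using cinner_adjoint_matrix[of "adjoint_matrix G" "G *v x" x]
    by (simp add: M cinner_self flip: matrix_vector_mul_assoc)
  then have "pos_semidef M" unfolding pos_semidef_def by simp
  then have S: "pos_semidef S" "S ** S = M" unfolding S_def by (rule matrix_sqrt)+
  define W where "W = matrix_inv S"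
  have "invertible S" using inv S(2) invertible_mult_left_factor by blast
  then have W: "S ** W = mat 1" unfolding W_def by (rule matrix_inv_inverse)
  have WS: "adjoint_matrix W ** S = mat 1"
    using arg_cong[OF W, of adjoint_matrix] pos_semidef_adjoint_matrix[OF S(1)]
    by (simp add: adjoint_matrix_mult)
  have "adjoint_matrix (G ** W) ** (G ** W) = adjoint_matrix W ** (adjoint_matrix G ** G) ** W"
    by (simp add: adjoint_matrix_mult matrix_mul_assoc)
  also have "\<dots> = (adjoint_matrix W ** S) ** (S ** W)"
    unfolding M[symmetric] S(2)[symmetric] by (simp add: matrix_mul_assoc)
  also have "\<dots> = mat 1" by (simp add: W WS)
  finally have "unitary_matrix (G ** W)" by (rule unitary_matrixI)
  then show ?thesis unfolding W_def S_def matrix_inv_sqrt_def .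
qed

text \<open>For square matrices, invertibility of the product passes to \<open>C\<close> and
  \<open>B\<close>. The common left factor \<open>C\<close> then cancels, and \<open>P\<close> is
  inverted by its adjoint.\<close>

lemma matrix_inv_mult_cancel:
  fixes C B P A Q :: "complex^'n^'n"
  assumes P: "unitary_matrix P" and inv: "invertible (C ** B ** P)"
  shows "matrix_inv (C ** B ** P) ** (C ** A ** Q) = adjoint_matrix P ** (matrix_inv B ** A) ** Q"
proof -
  have CB: "invertible (C ** B)" using inv by (rule invertible_mult_left_factor)
  then have C: "invertible C" and B: "invertible B"
    by (auto dest: invertible_mult_left_factor invertible_mult_right_factor)
  have PP: "P ** adjoint_matrix P = mat 1" using P unfolding unitary_matrix_def by blast
  have "C ** B ** P ** (adjoint_matrix P ** matrix_inv B ** matrix_inv C)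
      = C ** (B ** (P ** adjoint_matrix P) ** matrix_inv B) ** matrix_inv C"
    by (simp only: matrix_mul_assoc)
  also have "\<dots> = mat 1"
    by (simp add: PP matrix_inv_inverse[OF B] matrix_inv_inverse[OF C])
  finally have "matrix_inv (C ** B ** P) = adjoint_matrix P ** matrix_inv B ** matrix_inv C"
    by (rule matrix_inv_eqI)
  then have "matrix_inv (C ** B ** P) ** (C ** A ** Q)
      = adjoint_matrix P ** matrix_inv B ** (matrix_inv C ** C) ** A ** Q"
    by (simp only: matrix_mul_assoc)
  then show ?thesis by (simp add: matrix_inv_inverse[OF C] matrix_mul_assoc)
qed

lemma scaleC_matrix_mult: "A ** (c *\<^sub>C B) ** C = c *\<^sub>C (A ** B ** C)"
  for A B C :: "complex^'n^'n"
  by (simp add: vec_eq_iff matrix_matrix_mult_def scaleC_vec_def scaleC_complex_def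
      sum_distrib_left sum_distrib_right ac_simps)

text \<open>Moving the second transfer to the other side conjugates its parameters, after which the
  cocycle law merges the two transfers.\<close>

lemma cross_gram_transfer_op:
  fixes T :: "'h::chilbert_space \<rightharpoonup> 'h"
  assumes T: "selfadjoint_op T" and z: "Im a \<noteq> 0" "Im b \<noteq> 0"
  shows "cross_gram (\<lambda>j. transfer_op T b c (u j)) (\<lambda>k. transfer_op T a (cnj b) (v k))
    = cross_gram (\<lambda>j. transfer_op T (cnj a) c (u j)) v"
proof -
  have "cinner (transfer_op T b c x) (transfer_op T a (cnj b) y) = cinner (transfer_op T (cnj a) c x) y"
    for x y
    using cinner_transfer_op[OF T, of "cnj a" b "transfer_op T b c x" y] z
    by (simp add: transfer_op_trans[OF T])
  then show ?thesis by (simp add: cross_gram_def)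
qed

theorem corollary4p3:
  fixes T T' :: "'h::chilbert_space \<rightharpoonup> 'h"
    and u :: "'n::finite \<Rightarrow> 'h"
    and \<Gamma> :: "complex \<Rightarrow> complex^'n \<Rightarrow> 'h"
  assumes "separable_space (euclidean :: 'h topology)"
    and "T \<in> \<S> CARD('n)"
    and "canonical_selfadjoint_extension T T'"
    and "is_onb_of u (Ker_shift (adjoint_op T) \<i>)"
    and "is_model T \<Gamma>"
  shows "\<exists>R Q. unitary_matrix R \<and> unitary_matrix Q \<and>
    (\<forall>z. 0 < Im z \<longrightarrow> livsic_w T' u z = R ** model_V \<Gamma> z ** Q)"
proof -
  have T': "selfadjoint_op T'" and sub: "T \<subseteq>\<^sub>m T'"
    using assms(3) unfolding canonical_selfadjoint_extension_def by blast+
  have dense: "densely_defined T" using assms(2) unfolding deficiency_class_def by blast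
  have u_on: "cross_gram u u = mat 1"
    using assms(4) unfolding is_onb_of_def cross_gram_def mat_def by (simp add: vec_eq_iff)
  have u_span: "cspan (range u) = orth_compl (Rng_shift T (cnj \<i>))"
    using assms(4) Ker_shift_adjoint_op[OF dense, of \<i>] unfolding is_onb_of_def by simp
  have \<Gamma>: "bounded_clinear (\<Gamma> z)" and \<Gamma>_range: "\<Gamma> z x \<in> orth_compl (Rng_shift T z)"
    if "Im z \<noteq> 0" for z x
    using assms(5) that rangeI[of "\<Gamma> z" x] unfolding is_model_def bij_betw_def by metis+
  have \<Gamma>_bij: "bij (model_kernel \<Gamma> l z)"
    if "(0 < Im l \<and> 0 < Im z) \<or> (Im l < 0 \<and> Im z < 0)" for l z
    using assms(5) that unfolding is_model_def by blast
  define g where "g z k = \<Gamma> z (axis k 1)" for z k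
  \<comment> \<open>For nonreal \<open>a\<close>, this carries the basis \<open>u\<close> of the
    defect space at \<open>\<i>\<close> into the kernel of the adjoint of \<open>T\<close> minus
    \<open>a\<close>.\<close>
  define f where "f a j = transfer_op T' a \<i> (u j)" for a j
  have f_i: "f \<i> = u" by (simp add: f_def fun_eq_iff)
  have "\<exists>C. g z = lin_comb (f (cnj z)) C" if z: "Im z \<noteq> 0" for z
  proof -
    have "\<exists>c. g z k = (\<Sum>l\<in>UNIV. c l *\<^sub>C f (cnj z) l)" for k
    proof -
      have cz: "Im (cnj z) \<noteq> 0" using z by simp
      \<comment> \<open>The vector \<open>g z k\<close> lies in the defect space at
        \<open>cnj z\<close>. It is transferred to \<open>\<i>\<close>, expanded in
        \<open>u\<close>, and transferred back.\<close>
      have "transfer_op T' \<i> (cnj z) (g z k) \<in> cspan (range u)"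
        unfolding u_span g_def
        by (rule transfer_op_orth_compl[OF T' sub]) (use \<Gamma>_range[OF z] in auto)
      then obtain c where "transfer_op T' \<i> (cnj z) (g z k) = (\<Sum>l\<in>UNIV. c l *\<^sub>C u l)"
        by (rule mem_cspan_range_expansion)
      then have "transfer_op T' (cnj z) \<i> (transfer_op T' \<i> (cnj z) (g z k))
          = (\<Sum>l\<in>UNIV. c l *\<^sub>C f (cnj z) l)"
        by (simp add: transfer_op_sum[OF T' cz] transfer_op_scaleC[OF T' cz] f_def)
      then show ?thesis using transfer_op_trans[OF T' cz, of \<i> "cnj z"] by auto
    qed
    then obtain c where c: "\<And>k. g z k = (\<Sum>l\<in>UNIV. c k l *\<^sub>C f (cnj z) l)" by metis
    have "g z = lin_comb (f (cnj z)) (\<chi> l k. c k l)" by (simp add: fun_eq_iff lin_comb_def c)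
    then show ?thesis by blast
  qed
  then obtain C where C: "\<And>z. Im z \<noteq> 0 \<Longrightarrow> g z = lin_comb (f (cnj z)) (C z)" by metis
  have kernel: "kernel_matrix \<Gamma> l z
      = adjoint_matrix (C z) ** cross_gram (f (cnj l)) (f (cnj z)) ** C l"
    if "Im l \<noteq> 0" "Im z \<noteq> 0" for l z
    using kernel_matrix_eq_cross_gram[of \<Gamma> z l, OF \<Gamma>[OF that(2)]] C[OF that(1)] C[OF that(2)]
    unfolding g_def[abs_def]
    by (simp add: cross_gram_lin_comb_left cross_gram_lin_comb_right matrix_mul_assoc)
  \<comment> \<open>The family \<open>f (- \<i>)\<close> is the image of \<open>u\<close> under the
    Cayley transform of \<open>T'\<close>, which is isometric.\<close>
  have f_on: "cross_gram (f (- \<i>)) (f (- \<i>)) = mat 1"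
    using cross_gram_transfer_op[OF T', of "- \<i>" "- \<i>" \<i> u u] u_on unfolding f_def[abs_def] by simp
  \<comment> \<open>Since \<open>cnj (- \<i>)\<close> is \<open>\<i>\<close>, the cocycle law leaves
    the transfer from \<open>\<i>\<close> to \<open>z\<close>, which is the operator in
    \<open>livsic_B\<close>.\<close>
  have B: "livsic_B T' u z = cross_gram (f (- \<i>)) (f (cnj z))" if "0 < Im z" for z
    using cross_gram_transfer_op[OF T', of "cnj z" "- \<i>" \<i> u u] that unfolding f_def[abs_def]
    by (simp add: livsic_B_def cross_gram_def transfer_op_def)
  \<comment> \<open>The operator in \<open>livsic_A\<close> is the transfer from
    \<open>- \<i>\<close> to \<open>z\<close>; its adjoint is the transfer from \<open>\<i>\<close>
    to \<open>cnj z\<close> that defines \<open>f (cnj z)\<close>.\<close>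
  have A: "livsic_A T' u z = cross_gram (f \<i>) (f (cnj z))" if "0 < Im z" for z
    using cross_gram_transfer_op[OF T', of "cnj z" \<i> \<i> u u] that
    using cinner_transfer_op[OF T', of z "- \<i>"]
    by (simp add: livsic_A_def cross_gram_def transfer_op_def f_def)
  define P where "P = C \<i> ** matrix_inv_sqrt (kernel_matrix \<Gamma> \<i> \<i>)"
  define Q where "Q = C (- \<i>) ** matrix_inv_sqrt (kernel_matrix \<Gamma> (- \<i>) (- \<i>))"
  have P: "unitary_matrix P"
    unfolding P_def using kernel[of \<i> \<i>] f_on
    by (intro unitary_polar_factor invertible_kernel_matrix \<Gamma> \<Gamma>_bij) auto
  \<comment> \<open>At \<open>- \<i>\<close> the relevant family is \<open>f \<i>\<close>, so
    orthonormality is that of \<open>u\<close> itself.\<close>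
  have Q: "unitary_matrix Q"
    unfolding Q_def using kernel[of "- \<i>" "- \<i>"] u_on
    by (intro unitary_polar_factor invertible_kernel_matrix \<Gamma> \<Gamma>_bij) (auto simp: f_i)
  \<comment> \<open>Solving the factorization of \<open>model_V\<close> for the Livsic function
    makes \<open>P\<close> and the adjoint of \<open>Q\<close> the two constant unitary
    matrices.\<close>
  have "livsic_w T' u z = P ** model_V \<Gamma> z ** adjoint_matrix Q" if z: "0 < Im z" for z
  proof -
    let ?C = "adjoint_matrix (C z)" and ?B = "livsic_B T' u z" and ?A = "livsic_A T' u z"
    have Phi: "model_Phi \<Gamma> z = ?C ** ?B ** P"
      using z by (simp add: model_Phi_def P_def kernel[of \<i> z] B matrix_mul_assoc)
    have Psi: "model_Psi \<Gamma> z = ?C ** ?A ** Q"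
      using z by (simp add: model_Psi_def Q_def kernel[of "- \<i>" z] A matrix_mul_assoc)
    \<comment> \<open>This product is the kernel matrix for \<open>\<i>\<close> and
      \<open>z\<close>, both in the upper half plane, where the model makes kernels
      bijective.\<close>
    have "invertible (?C ** ?B ** C \<i>)"
      using z invertible_kernel_matrix[of \<Gamma> \<i> z, OF \<Gamma> \<Gamma> \<Gamma>_bij] by (simp add: kernel[of \<i> z] B)
    then have "invertible (?C ** ?B)" by (rule invertible_mult_left_factor)
    moreover have "invertible P"
      using P unfolding unitary_matrix_def invertible_def by blast
    ultimately have "invertible (?C ** ?B ** P)" by (rule invertible_mult)
    from matrix_inv_mult_cancel[OF P this]
    have "model_V \<Gamma> z = b_factor z *\<^sub>C (adjoint_matrix P ** (matrix_inv ?B ** ?A) ** Q)"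
      unfolding model_V_def Phi Psi by simp
    then have "P ** model_V \<Gamma> z ** adjoint_matrix Q
        = b_factor z *\<^sub>C ((P ** adjoint_matrix P) ** (matrix_inv ?B ** ?A) ** (Q ** adjoint_matrix Q))"
      by (simp only: scaleC_matrix_mult matrix_mul_assoc)
    also have "\<dots> = livsic_w T' u z"
      using P Q unfolding unitary_matrix_def livsic_w_def by simp
    finally show ?thesis ..
  qed
  with P unitary_adjoint_matrix[OF Q] show ?thesis by blast
qed

end
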